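(* The following is provable in $\mathrm{HA}^\omega$ together with the defining equation of $\mathsf{eps}$. Let $q\colon\Pi_iX_i\to R$, $\ell\colon R\to\mathbb{N}$ and $\varepsilon\colon\Pi_iJ_RX_i$ be given. Define $$\alpha = \mathsf{eps}^\ell_0(\varepsilon)(q),\qquad p_n(x)=\overline{\mathsf{eps}^\ell_{n+1}(\varepsilon)}(q_{[\alpha](n)*x})\quad (x\colon X_n).$$ Then for all $n\le \ell(q(\alpha))$ we have $$\alpha(n)=\varepsilon_n(p_n)\ \text{ (in } X_n),\qquad p_n(\alpha(n))=q(\alpha)\ \text{ (in } R).$$
   Context: Types and systems. Finite types are generated from $\mathbb{B}$ (booleans) and $\mathbb{N}$ by $X\times Y$, $X\to Y$ and $X^*$ (finite sequences). For a sequence of types $(X_i)_{i\in\mathbb{N}}$, $\Pi_i X_i$ is the type of infinite sequences whose $i$-th entry is in $X_i$ and $\Pi_{i<n}X_i$ the type of finite sequences of length $n$. (This is used for readability; one may take all $X_i$ equal to one type $X$, reading $\Pi_iX_i$ as $\mathbb{N}\to X$ and finite sequence types as $X^*$.) $\mathrm{HA}^\omega$ is Heyting arithmetic in all finite types with fully extensional equality (Troelstra's E-$\mathrm{HA}^\omega$). $\mathbf{0}$ denotes the canonical zero object of each type (the zero sequence for sequence types). Notation. $*$ is concatenation. For a finite sequence $s$ and functional $q$ on infinite sequences, $q_s(\beta)=q(s*\beta)$ (and $q_x=q_{\langle x\rangle}$). $[\alpha](n)=\langle\alpha(0),\dots,\alpha(n-1)\rangle$. $J_RX=(X\to R)\to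 X$; for a selection function $\delta\colon J_RX$, $\overline{\delta}(p)=p(\delta(p))$. $\mathsf{eps}$. For $\varepsilon\colon\Pi_kJ_RX_k$, $\ell\colon R\to\mathbb{N}$, $q\colon\Pi_iX_{i+n}\to R$, the value $\mathsf{eps}^\ell_n(\varepsilon)(q)\colon\Pi_iX_{i+n}$ is specified by: $\mathsf{eps}^\ell_n(\varepsilon)(q)=\mathbf{0}$ if $\ell(q(\mathbf{0}))<n$, and otherwise $\mathsf{eps}^\ell_n(\varepsilon)(q)=c*\mathsf{eps}^\ell_{n+1}(\varepsilon)(q_c)$, where $c=\varepsilon_n(\lambda x.\,\overline{\mathsf{eps}^\ell_{n+1}(\varepsilon)}(q_x))$. *)

theory Defs
  imports Main
begin

text \<open>
  The claim is one about provability in Heyting arithmetic in all finite types, so the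
  formal system itself is defined here: finite types, typed terms, formulas and
  intuitionistic derivability for \<open>E-HA\<^sup>\<omega>\<close>, over a language that also contains the
  constants \<open>eps\<close>. The system \<open>E-HA\<^sup>\<omega>\<close> is the derivability relation \<open>\<Gamma> \<turnstile> \<phi>\<close>;
  the defining equation of \<open>eps\<close> is not a rule but is supplied through \<open>\<Gamma>\<close>.
\<close>

section \<open>Types, terms and formulas\<close>

datatype ty =
    TBool
  | TNat
  | TProd ty ty
  | TFun ty ty (infixr "\<rightarrow>" 65)
  | TSeq ty

abbreviation TInf :: "ty \<Rightarrow> ty" where
  "TInf X \<equiv> TNat \<rightarrow> X"

abbreviation TSel :: "ty \<Rightarrow> ty \<Rightarrow> ty" where
  "TSel R X \<equiv> (X \<rightarrow> R) \<rightarrow> X"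

text \<open>
  Finite sequences are generated from the empty sequence by appending one entry on the
  right: \<open>CSnoc\<close> is \<open>s, x \<mapsto> s * \<langle>x\<rangle>\<close>. The constants \<open>CRec\<close> and \<open>CSRec\<close> are the
  recursors for numbers and for finite sequences.
\<close>

datatype const =
    CTrue | CFalse | CCond ty
  | CZero | CSuc | CRec ty
  | CPair ty ty | CFst ty ty | CSnd ty ty
  | CEmpty ty | CSnoc ty | CSRec ty ty
  | CEps ty ty

fun const_type :: "const \<Rightarrow> ty" where
  "const_type CTrue = TBool"
| "const_type CFalse = TBool"
| "const_type (CCond T) = TBool \<rightarrow> T \<rightarrow> T \<rightarrow> T"
| "const_type CZero = TNat"
| "const_type CSuc = TNat \<rightarrow> TNat"
| "const_type (CRec T) = T \<rightarrow> (TNat \<rightarrow> T \<rightarrow> T) \<rightarrow> TNat \<rightarrow> T"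
| "const_type (CPair S T) = S \<rightarrow> T \<rightarrow> TProd S T"
| "const_type (CFst S T) = TProd S T \<rightarrow> S"
| "const_type (CSnd S T) = TProd S T \<rightarrow> T"
| "const_type (CEmpty X) = TSeq X"
| "const_type (CSnoc X) = TSeq X \<rightarrow> X \<rightarrow> TSeq X"
| "const_type (CSRec X T) = T \<rightarrow> (TSeq X \<rightarrow> X \<rightarrow> T \<rightarrow> T) \<rightarrow> TSeq X \<rightarrow> T"
| "const_type (CEps X R) =
     (R \<rightarrow> TNat) \<rightarrow> TNat \<rightarrow> (TNat \<rightarrow> TSel R X) \<rightarrow> (TInf X \<rightarrow> R) \<rightarrow> TInf X"

text \<open>
  A variable carries its type; variables with the same name and different types are
  different variables.
\<close>

type_synonym var = "string \<times> ty"

datatype tm =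
    Var var
  | Con const
  | App tm tm (infixl "\<cdot>" 90)
  | Lam var tm

datatype fm =
    Eq tm tm (infix "\<^bold>=" 60)
  | Fls
  | And fm fm (infixr "\<^bold>\<and>" 55)
  | Or fm fm (infixr "\<^bold>\<or>" 54)
  | Imp fm fm (infixr "\<^bold>\<longrightarrow>" 53)
  | All var fm
  | Ex var fm

abbreviation Neg :: "fm \<Rightarrow> fm" where
  "Neg \<phi> \<equiv> \<phi> \<^bold>\<longrightarrow> Fls"

fun tm_type :: "tm \<Rightarrow> ty option" where
  "tm_type (Var v) = Some (snd v)"
| "tm_type (Con c) = Some (const_type c)"
| "tm_type (t \<cdot> u) =
     (case (tm_type t, tm_type u) of
        (Some (S \<rightarrow> T), Some S') \<Rightarrow> if S = S' then Some T else None
      | _ \<Rightarrow> None)"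
| "tm_type (Lam v t) = map_option (TFun (snd v)) (tm_type t)"

text \<open>Equality is primitive at every type.\<close>

fun wf_fm :: "fm \<Rightarrow> bool" where
  "wf_fm (t \<^bold>= u) = (tm_type t \<noteq> None \<and> tm_type t = tm_type u)"
| "wf_fm Fls = True"
| "wf_fm (\<phi> \<^bold>\<and> \<psi>) = (wf_fm \<phi> \<and> wf_fm \<psi>)"
| "wf_fm (\<phi> \<^bold>\<or> \<psi>) = (wf_fm \<phi> \<and> wf_fm \<psi>)"
| "wf_fm (\<phi> \<^bold>\<longrightarrow> \<psi>) = (wf_fm \<phi> \<and> wf_fm \<psi>)"
| "wf_fm (All v \<phi>) = wf_fm \<phi>"
| "wf_fm (Ex v \<phi>) = wf_fm \<phi>"

fun tm_fv :: "tm \<Rightarrow> var set" where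
  "tm_fv (Var v) = {v}"
| "tm_fv (Con c) = {}"
| "tm_fv (t \<cdot> u) = tm_fv t \<union> tm_fv u"
| "tm_fv (Lam v t) = tm_fv t - {v}"

fun fm_fv :: "fm \<Rightarrow> var set" where
  "fm_fv (t \<^bold>= u) = tm_fv t \<union> tm_fv u"
| "fm_fv Fls = {}"
| "fm_fv (\<phi> \<^bold>\<and> \<psi>) = fm_fv \<phi> \<union> fm_fv \<psi>"
| "fm_fv (\<phi> \<^bold>\<or> \<psi>) = fm_fv \<phi> \<union> fm_fv \<psi>"
| "fm_fv (\<phi> \<^bold>\<longrightarrow> \<psi>) = fm_fv \<phi> \<union> fm_fv \<psi>"
| "fm_fv (All v \<phi>) = fm_fv \<phi> - {v}"
| "fm_fv (Ex v \<phi>) = fm_fv \<phi> - {v}"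

text \<open>
  \<open>tm_subst v s t\<close> and \<open>fm_subst v s \<phi>\<close> replace the free occurrences of \<open>v\<close> by \<open>s\<close>
  without renaming bound variables. They are used only when \<open>s\<close> is free for \<open>v\<close>, that is,
  when no variable of \<open>s\<close> gets captured (\<open>tm_free_for\<close>, \<open>fm_free_for\<close>).
\<close>

fun tm_subst :: "var \<Rightarrow> tm \<Rightarrow> tm \<Rightarrow> tm" where
  "tm_subst v s (Var w) = (if w = v then s else Var w)"
| "tm_subst v s (Con c) = Con c"
| "tm_subst v s (t \<cdot> u) = tm_subst v s t \<cdot> tm_subst v s u"
| "tm_subst v s (Lam w t) = Lam w (if w = v then t else tm_subst v s t)"

fun fm_subst :: "var \<Rightarrow> tm \<Rightarrow> fm \<Rightarrow> fm" where
  "fm_subst v s (t \<^bold>= u) = (tm_subst v s t \<^bold>= tm_subst v s u)"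
| "fm_subst v s Fls = Fls"
| "fm_subst v s (\<phi> \<^bold>\<and> \<psi>) = (fm_subst v s \<phi> \<^bold>\<and> fm_subst v s \<psi>)"
| "fm_subst v s (\<phi> \<^bold>\<or> \<psi>) = (fm_subst v s \<phi> \<^bold>\<or> fm_subst v s \<psi>)"
| "fm_subst v s (\<phi> \<^bold>\<longrightarrow> \<psi>) = (fm_subst v s \<phi> \<^bold>\<longrightarrow> fm_subst v s \<psi>)"
| "fm_subst v s (All w \<phi>) = All w (if w = v then \<phi> else fm_subst v s \<phi>)"
| "fm_subst v s (Ex w \<phi>) = Ex w (if w = v then \<phi> else fm_subst v s \<phi>)"

fun tm_free_for :: "tm \<Rightarrow> var \<Rightarrow> tm \<Rightarrow> bool" where
  "tm_free_for s v (Var w) = True"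
| "tm_free_for s v (Con c) = True"
| "tm_free_for s v (t \<cdot> u) = (tm_free_for s v t \<and> tm_free_for s v u)"
| "tm_free_for s v (Lam w t) = (v \<notin> tm_fv (Lam w t) \<or> w \<notin> tm_fv s \<and> tm_free_for s v t)"

fun fm_free_for :: "tm \<Rightarrow> var \<Rightarrow> fm \<Rightarrow> bool" where
  "fm_free_for s v (t \<^bold>= u) = (tm_free_for s v t \<and> tm_free_for s v u)"
| "fm_free_for s v Fls = True"
| "fm_free_for s v (\<phi> \<^bold>\<and> \<psi>) = (fm_free_for s v \<phi> \<and> fm_free_for s v \<psi>)"
| "fm_free_for s v (\<phi> \<^bold>\<or> \<psi>) = (fm_free_for s v \<phi> \<and> fm_free_for s v \<psi>)"
| "fm_free_for s v (\<phi> \<^bold>\<longrightarrow> \<psi>) = (fm_free_for s v \<phi> \<and> fm_free_for s v \<psi>)"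
| "fm_free_for s v (All w \<phi>) = (v \<notin> fm_fv (All w \<phi>) \<or> w \<notin> tm_fv s \<and> fm_free_for s v \<phi>)"
| "fm_free_for s v (Ex w \<phi>) = (v \<notin> fm_fv (Ex w \<phi>) \<or> w \<notin> tm_fv s \<and> fm_free_for s v \<phi>)"


section \<open>Heyting arithmetic in all finite types\<close>

text \<open>
  Non-logical axioms; only well-formed instances enter the derivability relation below.
  The remaining disjointness and injectivity statements for the generators of \<open>TBool\<close>,
  \<open>TProd\<close> and \<open>TSeq\<close> are derivable with the conditional, the projections and the
  recursors.
\<close>

inductive ha_axiom :: "fm \<Rightarrow> bool" where
  suc_not_zero: "ha_axiom (Neg (Con CSuc \<cdot> t \<^bold>= Con CZero))"
| suc_inj: "ha_axiom ((Con CSuc \<cdot> t \<^bold>= Con CSuc \<cdot> u) \<^bold>\<longrightarrow> (t \<^bold>= u))"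
| nat_induct: "v = (x, TNat) \<Longrightarrow>
    ha_axiom (fm_subst v (Con CZero) \<phi> \<^bold>\<longrightarrow>
      All v (\<phi> \<^bold>\<longrightarrow> fm_subst v (Con CSuc \<cdot> Var v) \<phi>) \<^bold>\<longrightarrow> All v \<phi>)"
| rec_zero: "ha_axiom (Con (CRec T) \<cdot> a \<cdot> f \<cdot> Con CZero \<^bold>= a)"
| rec_suc: "ha_axiom (Con (CRec T) \<cdot> a \<cdot> f \<cdot> (Con CSuc \<cdot> t) \<^bold>= f \<cdot> t \<cdot> (Con (CRec T) \<cdot> a \<cdot> f \<cdot> t))"
| bool_induct: "v = (x, TBool) \<Longrightarrow>
    ha_axiom (fm_subst v (Con CTrue) \<phi> \<^bold>\<longrightarrow> fm_subst v (Con CFalse) \<phi> \<^bold>\<longrightarrow> All v \<phi>)"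
| cond_true: "ha_axiom (Con (CCond T) \<cdot> Con CTrue \<cdot> a \<cdot> b \<^bold>= a)"
| cond_false: "ha_axiom (Con (CCond T) \<cdot> Con CFalse \<cdot> a \<cdot> b \<^bold>= b)"
| fst_pair: "ha_axiom (Con (CFst S T) \<cdot> (Con (CPair S T) \<cdot> a \<cdot> b) \<^bold>= a)"
| snd_pair: "ha_axiom (Con (CSnd S T) \<cdot> (Con (CPair S T) \<cdot> a \<cdot> b) \<^bold>= b)"
| pair_surj: "ha_axiom (Con (CPair S T) \<cdot> (Con (CFst S T) \<cdot> p) \<cdot> (Con (CSnd S T) \<cdot> p) \<^bold>= p)"
| seq_induct: "v = (x, TSeq X) \<Longrightarrow> w = (y, X) \<Longrightarrow> w \<notin> fm_fv \<phi> \<Longrightarrow>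
    fm_free_for (Con (CSnoc X) \<cdot> Var v \<cdot> Var w) v \<phi> \<Longrightarrow>
    ha_axiom (fm_subst v (Con (CEmpty X)) \<phi> \<^bold>\<longrightarrow>
      All v (All w (\<phi> \<^bold>\<longrightarrow> fm_subst v (Con (CSnoc X) \<cdot> Var v \<cdot> Var w) \<phi>)) \<^bold>\<longrightarrow> All v \<phi>)"
| srec_empty: "ha_axiom (Con (CSRec X T) \<cdot> a \<cdot> f \<cdot> Con (CEmpty X) \<^bold>= a)"
| srec_snoc: "ha_axiom (Con (CSRec X T) \<cdot> a \<cdot> f \<cdot> (Con (CSnoc X) \<cdot> s \<cdot> t)
    \<^bold>= f \<cdot> s \<cdot> t \<cdot> (Con (CSRec X T) \<cdot> a \<cdot> f \<cdot> s))"

text \<open>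
  Natural deduction for intuitionistic logic with equality, \<open>\<beta>\<close>-conversion and full
  extensionality. The rule \<open>ext\<close> may be used under arbitrary hypotheses, so it yields the
  extensionality axiom of \<open>E-HA\<^sup>\<omega>\<close> and not merely the extensionality rule; together with
  \<open>beta\<close> it yields \<open>\<xi>\<close> and \<open>\<eta>\<close>.
\<close>

inductive derivable :: "fm set \<Rightarrow> fm \<Rightarrow> bool" (infix "\<turnstile>" 50) where
  hyp: "\<phi> \<in> \<Gamma> \<Longrightarrow> wf_fm \<phi> \<Longrightarrow> \<Gamma> \<turnstile> \<phi>"
| ax: "ha_axiom \<phi> \<Longrightarrow> wf_fm \<phi> \<Longrightarrow> \<Gamma> \<turnstile> \<phi>"
| FlsE: "\<Gamma> \<turnstile> Fls \<Longrightarrow> wf_fm \<phi> \<Longrightarrow> \<Gamma> \<turnstile> \<phi>"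
| AndI: "\<Gamma> \<turnstile> \<phi> \<Longrightarrow> \<Gamma> \<turnstile> \<psi> \<Longrightarrow> \<Gamma> \<turnstile> \<phi> \<^bold>\<and> \<psi>"
| AndE1: "\<Gamma> \<turnstile> \<phi> \<^bold>\<and> \<psi> \<Longrightarrow> \<Gamma> \<turnstile> \<phi>"
| AndE2: "\<Gamma> \<turnstile> \<phi> \<^bold>\<and> \<psi> \<Longrightarrow> \<Gamma> \<turnstile> \<psi>"
| OrI1: "\<Gamma> \<turnstile> \<phi> \<Longrightarrow> wf_fm \<psi> \<Longrightarrow> \<Gamma> \<turnstile> \<phi> \<^bold>\<or> \<psi>"
| OrI2: "\<Gamma> \<turnstile> \<psi> \<Longrightarrow> wf_fm \<phi> \<Longrightarrow> \<Gamma> \<turnstile> \<phi> \<^bold>\<or> \<psi>"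
| OrE: "\<Gamma> \<turnstile> \<phi> \<^bold>\<or> \<psi> \<Longrightarrow> insert \<phi> \<Gamma> \<turnstile> \<chi> \<Longrightarrow> insert \<psi> \<Gamma> \<turnstile> \<chi> \<Longrightarrow> \<Gamma> \<turnstile> \<chi>"
| ImpI: "insert \<phi> \<Gamma> \<turnstile> \<psi> \<Longrightarrow> wf_fm \<phi> \<Longrightarrow> \<Gamma> \<turnstile> \<phi> \<^bold>\<longrightarrow> \<psi>"
| ImpE: "\<Gamma> \<turnstile> \<phi> \<^bold>\<longrightarrow> \<psi> \<Longrightarrow> \<Gamma> \<turnstile> \<phi> \<Longrightarrow> \<Gamma> \<turnstile> \<psi>"
| AllI: "\<Gamma> \<turnstile> \<phi> \<Longrightarrow> \<forall>\<psi>\<in>\<Gamma>. v \<notin> fm_fv \<psi> \<Longrightarrow> \<Gamma> \<turnstile> All v \<phi>"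
| AllE: "\<Gamma> \<turnstile> All v \<phi> \<Longrightarrow> tm_type t = Some (snd v) \<Longrightarrow> fm_free_for t v \<phi> \<Longrightarrow>
    \<Gamma> \<turnstile> fm_subst v t \<phi>"
| ExI: "\<Gamma> \<turnstile> fm_subst v t \<phi> \<Longrightarrow> tm_type t = Some (snd v) \<Longrightarrow> fm_free_for t v \<phi> \<Longrightarrow>
    \<Gamma> \<turnstile> Ex v \<phi>"
| ExE: "\<Gamma> \<turnstile> Ex v \<phi> \<Longrightarrow> insert \<phi> \<Gamma> \<turnstile> \<chi> \<Longrightarrow> \<forall>\<psi>\<in>\<Gamma>. v \<notin> fm_fv \<psi> \<Longrightarrow> v \<notin> fm_fv \<chi> \<Longrightarrow>
    \<Gamma> \<turnstile> \<chi>"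
| refl: "tm_type t \<noteq> None \<Longrightarrow> \<Gamma> \<turnstile> t \<^bold>= t"
| leibniz: "\<Gamma> \<turnstile> s \<^bold>= t \<Longrightarrow> \<Gamma> \<turnstile> fm_subst v s \<phi> \<Longrightarrow> tm_type s = Some (snd v) \<Longrightarrow>
    fm_free_for s v \<phi> \<Longrightarrow> fm_free_for t v \<phi> \<Longrightarrow> \<Gamma> \<turnstile> fm_subst v t \<phi>"
| beta: "tm_type (Lam v t \<cdot> s) \<noteq> None \<Longrightarrow> tm_free_for s v t \<Longrightarrow>
    \<Gamma> \<turnstile> Lam v t \<cdot> s \<^bold>= tm_subst v s t"
| ext: "\<Gamma> \<turnstile> All v (s \<cdot> Var v \<^bold>= t \<cdot> Var v) \<Longrightarrow> v \<notin> tm_fv s \<union> tm_fv t \<Longrightarrow> \<Gamma> \<turnstile> s \<^bold>= t"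

lemma tm_type_subst: "tm_type s = Some (snd v) \<Longrightarrow> tm_type (tm_subst v s t) = tm_type t"
  by (induction t) auto

lemma wf_fm_subst: "tm_type s = Some (snd v) \<Longrightarrow> wf_fm (fm_subst v s \<phi>) = wf_fm \<phi>"
  by (induction \<phi>) (auto simp: tm_type_subst)

lemma derivable_wf: "\<Gamma> \<turnstile> \<phi> \<Longrightarrow> wf_fm \<phi>"
proof (induction rule: derivable.induct)
  case (ext \<Gamma> v s t)
  then show ?case by (auto split: option.splits ty.splits if_splits)
next
  case (leibniz \<Gamma> s t v \<phi>)
  then show ?case by (auto simp: wf_fm_subst)
next
  case (beta v t s)
  then show ?case by (auto simp: tm_type_subst split: option.splits ty.splits if_splits)
qed (auto simp: wf_fm_subst)


section \<open>Closed terms for the operations on sequences\<close>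

fun zero :: "ty \<Rightarrow> tm" where
  "zero TBool = Con CFalse"
| "zero TNat = Con CZero"
| "zero (TProd S T) = Con (CPair S T) \<cdot> zero S \<cdot> zero T"
| "zero (S \<rightarrow> T) = Lam (''x'', S) (zero T)"
| "zero (TSeq X) = Con (CEmpty X)"

definition suc :: "tm \<Rightarrow> tm" where
  "suc t = Con CSuc \<cdot> t"

definition pred :: tm where
  "pred = (let m = (''m'', TNat); i = (''i'', TNat); k = (''k'', TNat) in
     Lam m (Con (CRec TNat) \<cdot> Con CZero \<cdot> Lam i (Lam k (Var i)) \<cdot> Var m))"

definition monus :: tm where
  "monus = (let m = (''m'', TNat); n = (''n'', TNat); i = (''i'', TNat); k = (''k'', TNat) in
     Lam m (Lam n (Con (CRec TNat) \<cdot> Var m \<cdot> Lam i (Lam k (pred \<cdot> Var k)) \<cdot> Var n)))"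

text \<open>The order on numbers: \<open>m \<le> n\<close> is the formula stating that the truncated difference is \<open>0\<close>.\<close>

definition Le :: "tm \<Rightarrow> tm \<Rightarrow> fm" where
  "Le t u = (monus \<cdot> t \<cdot> u \<^bold>= Con CZero)"

definition Less :: "tm \<Rightarrow> tm \<Rightarrow> fm" where
  "Less t u = Le (suc t) u"

text \<open>The infinite sequence with first entry \<open>x\<close> followed by \<open>\<beta>\<close>.\<close>

definition cons :: "ty \<Rightarrow> tm" where
  "cons X = (let x = (''x'', X); b = (''b'', TInf X); i = (''i'', TNat);
       j = (''j'', TNat); y = (''y'', X) in
     Lam x (Lam b (Lam i
       (Con (CRec X) \<cdot> Var x \<cdot> Lam j (Lam y (Var b \<cdot> Var j)) \<cdot> Var i))))"

text \<open>
  Concatenation of a finite and an infinite sequence: \<open>\<langle>\<rangle> * \<beta> = \<beta>\<close> and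
  \<open>(s * \<langle>x\<rangle>) * \<beta> = s * (x * \<beta>)\<close>, by recursion on the finite sequence at the type of
  maps on infinite sequences.
\<close>

definition conc :: "ty \<Rightarrow> tm" where
  "conc X = (let s = (''s'', TSeq X); x = (''x'', X); b = (''b'', TInf X);
       f = (''f'', TInf X \<rightarrow> TInf X) in
     Con (CSRec X (TInf X \<rightarrow> TInf X)) \<cdot> Lam b (Var b)
       \<cdot> Lam s (Lam x (Lam f (Lam b (Var f \<cdot> (cons X \<cdot> Var x \<cdot> Var b))))))"

text \<open>\<open>sing X t\<close> is \<open>\<langle>t\<rangle>\<close>.\<close>

definition sing :: "ty \<Rightarrow> tm \<Rightarrow> tm" where
  "sing X t = Con (CSnoc X) \<cdot> Con (CEmpty X) \<cdot> t"

text \<open>The initial segment \<open>\<alpha>, n \<mapsto> \<langle>\<alpha>(0), \<dots>, \<alpha>(n-1)\<rangle>\<close>.\<close>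

definition init :: "ty \<Rightarrow> tm" where
  "init X = (let a = (''a'', TInf X); n = (''n'', TNat); i = (''i'', TNat);
       s = (''s'', TSeq X) in
     Lam a (Lam n (Con (CRec (TSeq X)) \<cdot> Con (CEmpty X)
       \<cdot> Lam i (Lam s (Con (CSnoc X) \<cdot> Var s \<cdot> (Var a \<cdot> Var i))) \<cdot> Var n)))"

text \<open>The map \<open>q, s \<mapsto> q\<^sub>s\<close>, where \<open>q\<^sub>s(\<beta>) = q(s * \<beta>)\<close>.\<close>

definition qsub :: "ty \<Rightarrow> ty \<Rightarrow> tm" where
  "qsub X R = (let q = (''q'', TInf X \<rightarrow> R); s = (''s'', TSeq X); b = (''b'', TInf X) in
     Lam q (Lam s (Lam b (Var q \<cdot> (conc X \<cdot> Var s \<cdot> Var b)))))"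

text \<open>The map \<open>\<delta>, p \<mapsto> p(\<delta>(p))\<close> for selection functions \<open>\<delta>\<close> of type \<open>TSel R X\<close>.\<close>

definition ovl :: "ty \<Rightarrow> ty \<Rightarrow> tm" where
  "ovl X R = (let d = (''d'', TSel R X); p = (''p'', X \<rightarrow> R) in
     Lam d (Lam p (Var p \<cdot> (Var d \<cdot> Var p))))"


section \<open>The defining equation of \<open>eps\<close>\<close>

text \<open>
  \<open>Con (CEps X R) \<cdot> \<ell> \<cdot> n \<cdot> \<epsilon> \<cdot> q\<close> is \<open>eps\<close> with control \<open>\<ell>\<close> and index \<open>n\<close>, applied to \<open>\<epsilon>\<close>
  and \<open>q\<close>. All entries of a sequence have one type \<open>X\<close>, so \<open>\<Pi>\<^sub>i X\<^sub>i\<close> is \<open>TInf X\<close> and the types of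
  finite sequences of entries are all \<open>TSeq X\<close>.
\<close>

definition eps_eq :: "ty \<Rightarrow> ty \<Rightarrow> fm" where
  "eps_eq X R = (let
       vl = (''l'', R \<rightarrow> TNat); vn = (''n'', TNat); ve = (''e'', TNat \<rightarrow> TSel R X);
       vq = (''q'', TInf X \<rightarrow> R); vx = (''x'', X);
       l = Var vl; n = Var vn; e = Var ve; q = Var vq; x = Var vx;
       eps = Con (CEps X R);
       c = e \<cdot> n \<cdot> Lam vx (ovl (TInf X) R \<cdot> (eps \<cdot> l \<cdot> suc n \<cdot> e) \<cdot> (qsub X R \<cdot> q \<cdot> sing X x));
       stop = Less (l \<cdot> (q \<cdot> zero (TInf X))) n
     in All vl (All vn (All ve (All vq (
          (stop \<^bold>\<longrightarrow> (eps \<cdot> l \<cdot> n \<cdot> e \<cdot> q \<^bold>= zero (TInf X))) \<^bold>\<and>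
          (Neg stop \<^bold>\<longrightarrow>
             (eps \<cdot> l \<cdot> n \<cdot> e \<cdot> q \<^bold>=
                conc X \<cdot> sing X c \<cdot> (eps \<cdot> l \<cdot> suc n \<cdot> e \<cdot> (qsub X R \<cdot> q \<cdot> sing X c)))))))))"

lemma tm_type_zero [simp]: "tm_type (zero T) = Some T"
  by (induction T) auto

lemma tm_fv_zero [simp]: "tm_fv (zero T) = {}"
  by (induction T) auto

lemma eps_eq_sentence: "wf_fm (eps_eq X R)" "fm_fv (eps_eq X R) = {}"
  by (auto simp: eps_eq_def Let_def Le_def Less_def qsub_def ovl_def conc_def cons_def sing_def
      monus_def pred_def suc_def)

definition eps_axioms :: "fm set" where
  "eps_axioms = {eps_eq X R | X R. True}"

end

theory Submission
  imports Defs
begin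

text \<open>
  Write \<open>A\<^sub>n\<close> for \<open>eps\<close> at index \<open>n\<close> and \<open>s\<^sub>n\<close> for the initial segment of \<open>\<alpha>\<close> of length \<open>n\<close>.
  Whether or not the recursion has stopped, \<open>A\<^sub>n(r) = a * A\<^sub>n\<^sub>+\<^sub>1(r\<^sub>a)\<close> with \<open>a\<close> the first entry of
  \<open>A\<^sub>n(r)\<close>. Induction on \<open>n\<close> gives \<open>\<alpha> = s\<^sub>n * A\<^sub>n(q\<^bsub>s n\<^esub>)\<close>; in particular \<open>\<alpha>(n)\<close> is the first entry of
  \<open>A\<^sub>n(q\<^bsub>s n\<^esub>)\<close>, and the case \<open>n + 1\<close> is the second claim. If the recursion stopped at \<open>n\<close>, then
  \<open>\<alpha> = s\<^sub>n * 0\<close> and the stopping condition would say \<open>\<ell>(q(\<alpha>)) < n\<close>; so for \<open>n \<le> \<ell>(q(\<alpha>))\<close> the first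
  entry of \<open>A\<^sub>n(q\<^bsub>s n\<^esub>)\<close> is \<open>\<epsilon>\<^sub>n(p\<^sub>n)\<close>.
\<close>

section \<open>Equational reasoning inside the formal system\<close>

lemma finite_tm_fv [simp]: "finite (tm_fv t)"
  by (induction t) auto

lemma finite_fm_fv [simp]: "finite (fm_fv \<phi>)"
  by (induction \<phi>) auto

lemma tm_subst_fresh [simp]: "v \<notin> tm_fv t \<Longrightarrow> tm_subst v s t = t"
  by (induction t) auto

lemma tm_subst_self [simp]: "tm_subst v (Var v) t = t"
  by (induction t) auto

lemma tm_free_for_fresh [simp]: "v \<notin> tm_fv t \<Longrightarrow> tm_free_for s v t"
  by (induction t) auto

lemma tm_free_for_self [simp]: "tm_free_for (Var v) v t"
  by (induction t) auto

lemma fm_subst_self [simp]: "fm_subst v (Var v) \<phi> = \<phi>"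
  by (induction \<phi>) auto

lemma fm_free_for_self [simp]: "fm_free_for (Var v) v \<phi>"
  by (induction \<phi>) auto

lemma fresh_var:
  assumes "finite A"
  obtains v :: var where "v \<notin> A" "snd v = T"
proof -
  have "infinite (UNIV :: string set)" by (rule infinite_UNIV_listI)
  moreover have "finite (fst ` A)" using assms by simp
  ultimately obtain x where "x \<notin> fst ` A" using ex_new_if_finite by blast
  then have "(x, T) \<notin> A" by force
  then show ?thesis by (rule that) simp
qed

section \<open>Provable equality as a typed congruence\<close>

lemma derivable_eq_types: "\<Gamma> \<turnstile> t \<^bold>= u \<Longrightarrow> tm_type t \<noteq> None \<and> tm_type u = tm_type t"
  using derivable_wf wf_fm.simps(1) by metis

text \<open>Leibniz replacement in the template \<open>Var v = s\<close>: its instance at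
  \<open>s\<close> is reflexivity, and \<open>v\<close> is fresh, so the right-hand \<open>s\<close>
  stays in place when \<open>t\<close> is put in.\<close>

lemma eq_sym: assumes "\<Gamma> \<turnstile> s \<^bold>= t" shows "\<Gamma> \<turnstile> t \<^bold>= s"
proof -
  obtain T where T: "tm_type s = Some T" "tm_type t = Some T" using derivable_eq_types[OF assms] by auto
  obtain v :: var where v: "v \<notin> tm_fv s" "snd v = T" using fresh_var[OF finite_tm_fv] .
  have "\<Gamma> \<turnstile> fm_subst v t (Var v \<^bold>= s)"
    by (rule leibniz[OF assms]) (use v T in \<open>auto intro: derivable.refl\<close>)
  then show ?thesis using v by simp
qed

lemma eq_trans: assumes "\<Gamma> \<turnstile> s \<^bold>= t" "\<Gamma> \<turnstile> t \<^bold>= u" shows "\<Gamma> \<turnstile> s \<^bold>= u"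
proof -
  obtain T where T: "tm_type t = Some T" "tm_type s = Some T" using derivable_eq_types[OF assms(1)] by auto
  obtain v :: var where v: "v \<notin> tm_fv s" "snd v = T" using fresh_var[OF finite_tm_fv] .
  have "\<Gamma> \<turnstile> fm_subst v u (s \<^bold>= Var v)"
    by (rule leibniz[OF assms(2)]) (use v T assms in auto)
  then show ?thesis using v by simp
qed

text \<open>Two Leibniz replacements, first of the function and then of the argument, starting from
  reflexivity of \<open>f \<cdot> a\<close>. The typing premise makes this starting formula well
  formed.\<close>

lemma eq_app:
  assumes "\<Gamma> \<turnstile> f \<^bold>= g" "\<Gamma> \<turnstile> a \<^bold>= b" "tm_type (f \<cdot> a) \<noteq> None"
  shows "\<Gamma> \<turnstile> f \<cdot> a \<^bold>= g \<cdot> b"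
proof -
  obtain T where T: "tm_type f = Some T" using derivable_eq_types[OF assms(1)] by auto
  obtain U where U: "tm_type a = Some U" using derivable_eq_types[OF assms(2)] by auto
  have "finite (tm_fv f \<union> tm_fv g \<union> tm_fv a)" by simp
  then obtain v :: var where v: "v \<notin> tm_fv f \<union> tm_fv g \<union> tm_fv a" "snd v = T" by (rule fresh_var)
  have 1: "\<Gamma> \<turnstile> fm_subst v g (f \<cdot> a \<^bold>= Var v \<cdot> a)"
    by (rule leibniz[OF assms(1)]) (use v T assms(3) in \<open>auto intro: derivable.refl\<close>)
  have "finite (tm_fv f \<union> tm_fv g \<union> tm_fv a)" by simp
  then obtain w :: var where w: "w \<notin> tm_fv f \<union> tm_fv g \<union> tm_fv a" "snd w = U" by (rule fresh_var)
  have "\<Gamma> \<turnstile> fm_subst w b (f \<cdot> a \<^bold>= g \<cdot> Var w)"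
    by (rule leibniz[OF assms(2)]) (use v w U 1 in auto)
  then show ?thesis using w by simp
qed

text \<open>
  \<open>nf \<Gamma> t\<close> is a representative of the class of \<open>t\<close> modulo \<open>\<Gamma>\<close>-provable equality, so that
  provable equality becomes equality of representatives and HOL rewriting applies. All
  ill-typed terms share one ill-typed representative, which makes the laws of \<open>nf\<close> and \<open>ap\<close>
  unconditional.
\<close>

definition nf :: "fm set \<Rightarrow> tm \<Rightarrow> tm" where
  "nf \<Gamma> t = (if tm_type t = None then Con CZero \<cdot> Con CZero else SOME u. \<Gamma> \<turnstile> t \<^bold>= u)"

definition ap :: "fm set \<Rightarrow> tm \<Rightarrow> tm \<Rightarrow> tm" where
  "ap \<Gamma> f a = nf \<Gamma> (f \<cdot> a)"

lemma eq_nf: "tm_type t \<noteq> None \<Longrightarrow> \<Gamma> \<turnstile> t \<^bold>= nf \<Gamma> t"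
  unfolding nf_def using someI[of "\<lambda>u. \<Gamma> \<turnstile> t \<^bold>= u" t] derivable.refl by auto

lemma tm_type_nf [simp]: "tm_type (nf \<Gamma> t) = tm_type t"
proof (cases "tm_type t = None")
  case False
  then show ?thesis using derivable_eq_types[OF eq_nf] by blast
qed (simp add: nf_def)

lemma nf_eqI: assumes "\<Gamma> \<turnstile> t \<^bold>= u" shows "nf \<Gamma> t = nf \<Gamma> u"
proof -
  have "(\<Gamma> \<turnstile> t \<^bold>= w) = (\<Gamma> \<turnstile> u \<^bold>= w)" for w
    using assms eq_sym eq_trans by blast
  then show ?thesis using derivable_eq_types[OF assms] by (auto simp: nf_def)
qed

lemma nf_eqD: assumes "nf \<Gamma> t = nf \<Gamma> u" "tm_type t \<noteq> None" shows "\<Gamma> \<turnstile> t \<^bold>= u"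
proof -
  have "tm_type u \<noteq> None" using assms by (metis tm_type_nf)
  then show ?thesis using eq_nf assms eq_sym eq_trans by metis
qed

lemma nf_nf [simp]: "nf \<Gamma> (nf \<Gamma> t) = nf \<Gamma> t"
proof (cases "tm_type t = None")
  case False
  then show ?thesis using nf_eqI[OF eq_nf] by simp
qed (simp add: nf_def)

lemma nf_App_cong:
  assumes "nf \<Gamma> f = nf \<Gamma> g" "nf \<Gamma> a = nf \<Gamma> b"
  shows "nf \<Gamma> (f \<cdot> a) = nf \<Gamma> (g \<cdot> b)"
proof (cases "tm_type (f \<cdot> a) = None")
  case True
  moreover have "tm_type f = tm_type g" "tm_type a = tm_type b" using assms by (metis tm_type_nf)+
  then have "tm_type (f \<cdot> a) = tm_type (g \<cdot> b)" by simp
  ultimately show ?thesis by (simp add: nf_def)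
next
  case False
  then have "tm_type f \<noteq> None" "tm_type a \<noteq> None" by (auto split: option.splits ty.splits)
  then show ?thesis using assms False by (blast intro: nf_eqI eq_app nf_eqD)
qed

text \<open>As rewrite rules these bring every term into one shape: object-level applications become
  nested \<open>ap\<close>, and \<open>nf\<close> survives only around a variable, constant or
  abstraction that is not applied. The simplifier then evaluates closed operations by their
  \<open>ap\<close> rules.\<close>

lemma ap_nf [simp]:
  "nf \<Gamma> (f \<cdot> a) = ap \<Gamma> f a" "nf \<Gamma> (ap \<Gamma> f a) = ap \<Gamma> f a"
  "ap \<Gamma> (nf \<Gamma> f) a = ap \<Gamma> f a" "ap \<Gamma> f (nf \<Gamma> a) = ap \<Gamma> f a"
  "ap \<Gamma> (f \<cdot> b) a = ap \<Gamma> (ap \<Gamma> f b) a" "ap \<Gamma> f (b \<cdot> c) = ap \<Gamma> f (ap \<Gamma> b c)"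
  by (auto simp: ap_def intro!: nf_App_cong)

lemma tm_type_ap [simp]: "tm_type (ap \<Gamma> f a) = tm_type (f \<cdot> a)"
  unfolding ap_def by (rule tm_type_nf)

lemma ap_cong: "nf \<Gamma> f = nf \<Gamma> g \<Longrightarrow> ap \<Gamma> f a = ap \<Gamma> g a"
  unfolding ap_def by (rule nf_App_cong) auto

lemma ap_Lam [simp]:
  "tm_type t \<noteq> None \<Longrightarrow> tm_type s = Some (snd v) \<Longrightarrow> tm_free_for s v t \<Longrightarrow>
    ap \<Gamma> (Lam v t) s = nf \<Gamma> (tm_subst v s t)"
  unfolding ap_def by (rule nf_eqI, rule beta) auto

lemma ax_eq: "ha_axiom (t \<^bold>= u) \<Longrightarrow> tm_type t \<noteq> None \<Longrightarrow> tm_type u = tm_type t \<Longrightarrow> nf \<Gamma> t = nf \<Gamma> u"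
  by (rule nf_eqI, rule ax) auto

text \<open>Turns an equation lying in the context, typically an induction hypothesis, into an
  equation of representatives.\<close>

lemma ap_hyp:
  assumes "(f \<cdot> a \<^bold>= g \<cdot> b) \<in> \<Gamma>" "wf_fm (f \<cdot> a \<^bold>= g \<cdot> b)"
  shows "ap \<Gamma> f a = ap \<Gamma> g b"
  unfolding ap_def by (rule nf_eqI, rule hyp[OF assms])

section \<open>The recursor axioms as rewrite rules\<close>

lemma ap_Rec_0 [simp]:
  assumes "tm_type a = Some T" "tm_type f = Some (TNat \<rightarrow> T \<rightarrow> T)"
  shows "ap \<Gamma> (ap \<Gamma> (ap \<Gamma> (Con (CRec T)) a) f) (Con CZero) = nf \<Gamma> a"
  using ax_eq[OF rec_zero[of T a f]] assms by simp

lemma ap_Rec_Suc [simp]: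
  assumes "tm_type a = Some T" "tm_type f = Some (TNat \<rightarrow> T \<rightarrow> T)" "tm_type t = Some TNat"
  shows "ap \<Gamma> (ap \<Gamma> (ap \<Gamma> (Con (CRec T)) a) f) (ap \<Gamma> (Con CSuc) t)
    = ap \<Gamma> (ap \<Gamma> f t) (ap \<Gamma> (ap \<Gamma> (ap \<Gamma> (Con (CRec T)) a) f) t)"
  using ax_eq[OF rec_suc[of T a f t]] assms by simp

lemma ap_SRec_Empty [simp]:
  assumes "tm_type a = Some T" "tm_type f = Some (TSeq X \<rightarrow> X \<rightarrow> T \<rightarrow> T)"
  shows "ap \<Gamma> (ap \<Gamma> (ap \<Gamma> (Con (CSRec X T)) a) f) (Con (CEmpty X)) = nf \<Gamma> a"
  using ax_eq[OF srec_empty[of X T a f]] assms by simp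

lemma ap_SRec_Snoc [simp]:
  assumes "tm_type a = Some T" "tm_type f = Some (TSeq X \<rightarrow> X \<rightarrow> T \<rightarrow> T)"
    "tm_type s = Some (TSeq X)" "tm_type t = Some X"
  shows "ap \<Gamma> (ap \<Gamma> (ap \<Gamma> (Con (CSRec X T)) a) f) (ap \<Gamma> (ap \<Gamma> (Con (CSnoc X)) s) t)
    = ap \<Gamma> (ap \<Gamma> (ap \<Gamma> f s) t) (ap \<Gamma> (ap \<Gamma> (ap \<Gamma> (Con (CSRec X T)) a) f) s)"
  using ax_eq[OF srec_snoc[of X T a f s t]] assms by simp

text \<open>
  Weakening of \<open>\<turnstile>\<close> would require renaming of bound variables; instead every fact is stated for
  an arbitrary context with finitely many free variables.
\<close>

locale ctx =
  fixes \<Gamma> :: "fm set"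
  assumes fin: "finite (\<Union>(fm_fv ` \<Gamma>))"
begin

lemma ctx_insert: "ctx (insert \<phi> \<Gamma>)"
  using fin by unfold_locales simp

lemma fresh_ctx:
  assumes "finite A"
  obtains v :: var where "v \<notin> A" "snd v = T" "\<forall>\<psi>\<in>\<Gamma>. v \<notin> fm_fv \<psi>"
proof -
  have "finite (A \<union> \<Union>(fm_fv ` \<Gamma>))" using assms fin by simp
  then obtain v :: var where "v \<notin> A \<union> \<Union>(fm_fv ` \<Gamma>)" "snd v = T" by (rule fresh_var)
  then show ?thesis using that by blast
qed

section \<open>Extensionality, induction and decidability in a context\<close>

lemma nf_ext:
  assumes "tm_type f = Some (S \<rightarrow> T)" "tm_type g = Some (S \<rightarrow> T)"
    and eq: "\<And>a. tm_type a = Some S \<Longrightarrow> ap \<Gamma> f a = ap \<Gamma> g a"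
  shows "nf \<Gamma> f = nf \<Gamma> g"
proof -
  have "finite (tm_fv f \<union> tm_fv g)" by simp
  then obtain v where v: "v \<notin> tm_fv f \<union> tm_fv g" "snd v = S" "\<forall>\<psi>\<in>\<Gamma>. v \<notin> fm_fv \<psi>"
    by (rule fresh_ctx)
  have "\<Gamma> \<turnstile> f \<cdot> Var v \<^bold>= g \<cdot> Var v"
    by (rule nf_eqD) (use v assms in auto)
  then have "\<Gamma> \<turnstile> All v (f \<cdot> Var v \<^bold>= g \<cdot> Var v)" using v by (blast intro: AllI)
  then show ?thesis using v by (blast intro: nf_eqI ext)
qed

lemma nf_ext2:
  assumes f: "tm_type f = Some (S \<rightarrow> S' \<rightarrow> T)" and g: "tm_type g = Some (S \<rightarrow> S' \<rightarrow> T)"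
    and eq: "\<And>a b. tm_type a = Some S \<Longrightarrow> tm_type b = Some S' \<Longrightarrow>
      ap \<Gamma> (ap \<Gamma> f a) b = ap \<Gamma> (ap \<Gamma> g a) b"
  shows "nf \<Gamma> f = nf \<Gamma> g"
proof (rule nf_ext[OF f g])
  fix a assume a: "tm_type a = Some S"
  have "nf \<Gamma> (ap \<Gamma> f a) = nf \<Gamma> (ap \<Gamma> g a)"
    by (rule nf_ext) (use f g a eq in auto)
  then show "ap \<Gamma> f a = ap \<Gamma> g a" by simp
qed

text \<open>Internal induction on the equation \<open>f \<cdot> v = g \<cdot> v\<close> for a fresh
  \<open>v\<close>, followed by extensionality. The induction hypothesis is an element of the larger
  context \<Delta>, hence the step is proved for another context than \<Gamma>. The set
  \<open>A\<close> lets the caller keep further variables away from the induction variable.\<close>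

lemma nf_nat_ext:
  assumes f: "tm_type f = Some (TNat \<rightarrow> T)" and g: "tm_type g = Some (TNat \<rightarrow> T)"
    and zero: "ap \<Gamma> f (Con CZero) = ap \<Gamma> g (Con CZero)"
    and "finite A"
    and step: "\<And>y \<Delta>. snd y = TNat \<Longrightarrow> y \<notin> A \<Longrightarrow> \<Gamma> \<subseteq> \<Delta> \<Longrightarrow> ctx \<Delta> \<Longrightarrow>
      (f \<cdot> Var y \<^bold>= g \<cdot> Var y) \<in> \<Delta> \<Longrightarrow>
      ap \<Delta> f (ap \<Delta> (Con CSuc) (Var y)) = ap \<Delta> g (ap \<Delta> (Con CSuc) (Var y))"
  shows "nf \<Gamma> f = nf \<Gamma> g"
proof -
  have "finite (tm_fv f \<union> tm_fv g \<union> A)" using \<open>finite A\<close> by simp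
  then obtain v where v: "v \<notin> tm_fv f \<union> tm_fv g \<union> A" "snd v = TNat" "\<forall>\<psi>\<in>\<Gamma>. v \<notin> fm_fv \<psi>"
    by (rule fresh_ctx)
  obtain x where x: "v = (x, TNat)" using v by (cases v) auto
  define \<phi> where "\<phi> = (f \<cdot> Var v \<^bold>= g \<cdot> Var v)"
  have wf: "wf_fm \<phi>" using f g v by (simp add: \<phi>_def)
  have z: "\<Gamma> \<turnstile> fm_subst v (Con CZero) \<phi>"
    using v f zero by (auto simp: \<phi>_def intro!: nf_eqD)
  have "ap (insert \<phi> \<Gamma>) f (ap (insert \<phi> \<Gamma>) (Con CSuc) (Var v))
    = ap (insert \<phi> \<Gamma>) g (ap (insert \<phi> \<Gamma>) (Con CSuc) (Var v))"
    by (rule step) (use v ctx_insert in \<open>auto simp: \<phi>_def\<close>)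
  then have "insert \<phi> \<Gamma> \<turnstile> fm_subst v (Con CSuc \<cdot> Var v) \<phi>"
    using v f by (auto simp: \<phi>_def intro!: nf_eqD)
  then have s: "\<Gamma> \<turnstile> All v (\<phi> \<^bold>\<longrightarrow> fm_subst v (Con CSuc \<cdot> Var v) \<phi>)"
    using v wf by (blast intro: AllI ImpI)
  have "\<Gamma> \<turnstile> fm_subst v (Con CZero) \<phi> \<^bold>\<longrightarrow>
      All v (\<phi> \<^bold>\<longrightarrow> fm_subst v (Con CSuc \<cdot> Var v) \<phi>) \<^bold>\<longrightarrow> All v \<phi>"
    by (rule ax, rule nat_induct[OF x]) (use wf derivable_wf[OF s] derivable_wf[OF z] in auto)
  then have "\<Gamma> \<turnstile> All v \<phi>" using z s ImpE by blast
  then show ?thesis using v unfolding \<phi>_def by (blast intro: nf_eqI ext)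
qed

text \<open>Internal induction: 0 falls under the left disjunct by reflexivity, a successor under
  the right one by the first axiom. Since \<open>Less\<close> is an equation with 0, this provides
  the case distinction on the stopping condition without classical logic.\<close>

lemma nat_eq_zero_decidable:
  assumes t: "tm_type t = Some TNat"
  shows "\<Gamma> \<turnstile> (t \<^bold>= Con CZero) \<^bold>\<or> Neg (t \<^bold>= Con CZero)"
proof -
  obtain v where v: "v \<notin> {}" "snd v = TNat" "\<forall>\<psi>\<in>\<Gamma>. v \<notin> fm_fv \<psi>"
    using fresh_ctx[OF finite.emptyI] .
  obtain x where x: "v = (x, TNat)" using v by (cases v) auto
  define \<phi> where "\<phi> = ((Var v \<^bold>= Con CZero) \<^bold>\<or> Neg (Var v \<^bold>= Con CZero))"
  have wf: "wf_fm \<phi>" using v by (simp add: \<phi>_def)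
  have z: "\<Gamma> \<turnstile> fm_subst v (Con CZero) \<phi>"
    by (auto simp: \<phi>_def intro!: OrI1 derivable.refl)
  have "insert \<phi> \<Gamma> \<turnstile> Neg (Con CSuc \<cdot> Var v \<^bold>= Con CZero)"
    by (rule ax, rule suc_not_zero) (use v in auto)
  then have "insert \<phi> \<Gamma> \<turnstile> fm_subst v (Con CSuc \<cdot> Var v) \<phi>"
    using v by (auto simp: \<phi>_def intro!: OrI2)
  then have s: "\<Gamma> \<turnstile> All v (\<phi> \<^bold>\<longrightarrow> fm_subst v (Con CSuc \<cdot> Var v) \<phi>)"
    using v wf by (blast intro: AllI ImpI)
  have "\<Gamma> \<turnstile> fm_subst v (Con CZero) \<phi> \<^bold>\<longrightarrow>
      All v (\<phi> \<^bold>\<longrightarrow> fm_subst v (Con CSuc \<cdot> Var v) \<phi>) \<^bold>\<longrightarrow> All v \<phi>"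
    by (rule ax, rule nat_induct[OF x]) (use wf derivable_wf[OF s] derivable_wf[OF z] in auto)
  then have "\<Gamma> \<turnstile> All v \<phi>" using z s ImpE by blast
  from AllE[OF this, of t] show ?thesis using t v by (simp add: \<phi>_def)
qed

end

text \<open>
  Outside the finite set \<open>A\<close> of variables, substitution acts on \<open>F a b c d\<close> only through the
  arguments and is never obstructed by binders of \<open>F\<close>.
\<close>

definition subst_stable :: "var set \<Rightarrow> (tm \<Rightarrow> tm \<Rightarrow> tm \<Rightarrow> tm \<Rightarrow> tm) \<Rightarrow> bool" where
  "subst_stable A F \<longleftrightarrow> (\<forall>v s a b c d. v \<notin> A \<longrightarrow>
     tm_subst v s (F a b c d)
       = F (tm_subst v s a) (tm_subst v s b) (tm_subst v s c) (tm_subst v s d) \<and>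
     (tm_free_for s v a \<longrightarrow> tm_free_for s v b \<longrightarrow> tm_free_for s v c \<longrightarrow> tm_free_for s v d \<longrightarrow>
       tm_free_for s v (F a b c d)))"

context ctx
begin

section \<open>From generic variables to arbitrary arguments\<close>

lemma eq_inst:
  assumes "\<Gamma> \<turnstile> a \<^bold>= b" "\<forall>\<psi>\<in>\<Gamma>. v \<notin> fm_fv \<psi>" "tm_type s = Some (snd v)"
    "tm_free_for s v a" "tm_free_for s v b"
  shows "\<Gamma> \<turnstile> tm_subst v s a \<^bold>= tm_subst v s b"
  using AllE[OF AllI[OF assms(1,2)] assms(3)] assms(4,5) by simp

text \<open>Substitution does not rename bound variables, so \<beta>-reduction with arbitrary
  arguments may be blocked by capture. For distinct variables outside \<open>A\<close> it is not;
  the equation is proved there, generalized, and instantiated one argument at a time. Operations of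
  smaller arity fill the remaining slots with \<open>Con CZero\<close>. Inequalities are supplied in
  both orientations for the simplifier.\<close>

lemma eq_generalize:
  assumes F: "subst_stable A F" and G: "subst_stable A G" and A: "finite A"
    and ty: "tm_type a = Some S1" "tm_type b = Some S2" "tm_type c = Some S3" "tm_type d = Some S4"
    and eq: "\<And>x y z w. \<lbrakk>snd x = S1; snd y = S2; snd z = S3; snd w = S4;
      \<forall>v\<in>A. x \<noteq> v \<and> y \<noteq> v \<and> z \<noteq> v \<and> w \<noteq> v; \<forall>v\<in>A. v \<noteq> x \<and> v \<noteq> y \<and> v \<noteq> z \<and> v \<noteq> w;
      x \<noteq> y; x \<noteq> z; x \<noteq> w; y \<noteq> z; y \<noteq> w; z \<noteq> w\<rbrakk> \<Longrightarrow>
      nf \<Gamma> (F (Var x) (Var y) (Var z) (Var w)) = nf \<Gamma> (G (Var x) (Var y) (Var z) (Var w)) \<and>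
      tm_type (F (Var x) (Var y) (Var z) (Var w)) \<noteq> None"
  shows "nf \<Gamma> (F a b c d) = nf \<Gamma> (G a b c d)"
proof -
  \<comment> \<open>The generic variables avoid the variables of all four arguments, so that
    replacing \<open>y\<close> by \<open>b\<close> leaves the already inserted \<open>a\<close>
    unchanged, and likewise for the later replacements.\<close>
  let ?B = "A \<union> tm_fv a \<union> tm_fv b \<union> tm_fv c \<union> tm_fv d"
  have "finite ?B" using A by simp
  then obtain x where x: "x \<notin> ?B" "snd x = S1" "\<forall>\<psi>\<in>\<Gamma>. x \<notin> fm_fv \<psi>" by (rule fresh_ctx)
  have "finite (insert x ?B)" using A by simp
  then obtain y where y: "y \<notin> insert x ?B" "snd y = S2" "\<forall>\<psi>\<in>\<Gamma>. y \<notin> fm_fv \<psi>" by (rule fresh_ctx)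
  have "finite (insert y (insert x ?B))" using A by simp
  then obtain z where z: "z \<notin> insert y (insert x ?B)" "snd z = S3" "\<forall>\<psi>\<in>\<Gamma>. z \<notin> fm_fv \<psi>"
    by (rule fresh_ctx)
  have "finite (insert z (insert y (insert x ?B)))" using A by simp
  then obtain w where w: "w \<notin> insert z (insert y (insert x ?B))" "snd w = S4" "\<forall>\<psi>\<in>\<Gamma>. w \<notin> fm_fv \<psi>"
    by (rule fresh_ctx)
  note sF = F[unfolded subst_stable_def, rule_format]
  note sG = G[unfolded subst_stable_def, rule_format]
  have 0: "\<Gamma> \<turnstile> F (Var x) (Var y) (Var z) (Var w) \<^bold>= G (Var x) (Var y) (Var z) (Var w)"
    by (rule nf_eqD; use eq[of x y z w] x y z w in fastforce)
  have 1: "\<Gamma> \<turnstile> F a (Var y) (Var z) (Var w) \<^bold>= G a (Var y) (Var z) (Var w)"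
    using eq_inst[OF 0 x(3), of a] x y z w ty sF sG by simp
  have 2: "\<Gamma> \<turnstile> F a b (Var z) (Var w) \<^bold>= G a b (Var z) (Var w)"
    using eq_inst[OF 1 y(3), of b] x y z w ty sF sG by simp
  have 3: "\<Gamma> \<turnstile> F a b c (Var w) \<^bold>= G a b c (Var w)"
    using eq_inst[OF 2 z(3), of c] x y z w ty sF sG by simp
  have 4: "\<Gamma> \<turnstile> F a b c d \<^bold>= G a b c d"
    using eq_inst[OF 3 w(3), of d] x y z w ty sF sG by simp
  then show ?thesis by (rule nf_eqI)
qed

end

text \<open>Induction through \<open>nf_nat_ext\<close> compares two terms of function type, so an
  expression in a number and parameters must first be abstracted into one term. The term is chosen
  before the context, which allows its equation to be used both in \<Gamma> and in the larger
  contexts of induction steps.\<close>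

lemma combinatory_completeness:
  assumes F: "subst_stable A (\<lambda>a b c d. F a b c)" and A: "finite A"
    and ty: "\<And>a b c. tm_type a = Some S1 \<Longrightarrow> tm_type b = Some S2 \<Longrightarrow> tm_type c = Some S3 \<Longrightarrow>
      tm_type (F a b c) = Some T"
  obtains f where "tm_type f = Some (S1 \<rightarrow> S2 \<rightarrow> S3 \<rightarrow> T)"
    "\<And>\<Gamma> a b c. ctx \<Gamma> \<Longrightarrow> tm_type a = Some S1 \<Longrightarrow> tm_type b = Some S2 \<Longrightarrow> tm_type c = Some S3 \<Longrightarrow>
      ap \<Gamma> (ap \<Gamma> (ap \<Gamma> f a) b) c = nf \<Gamma> (F a b c)"
proof -
  obtain x :: var where x: "x \<notin> A" "snd x = S1" using fresh_var[OF A] .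
  have "finite (insert x A)" using A by simp
  then obtain y :: var where y: "y \<notin> insert x A" "snd y = S2" by (rule fresh_var)
  have "finite (insert y (insert x A))" using A by simp
  then obtain z :: var where z: "z \<notin> insert y (insert x A)" "snd z = S3" by (rule fresh_var)
  define f where "f = Lam x (Lam y (Lam z (F (Var x) (Var y) (Var z))))"
  have tf: "tm_type f = Some (S1 \<rightarrow> S2 \<rightarrow> S3 \<rightarrow> T)"
    using ty x y z by (simp add: f_def)
  \<comment> \<open>The binders \<open>x\<close>, \<open>y\<close>, \<open>z\<close> are avoided so
    that generic arguments are not captured when \<open>f\<close> is reduced, and the free variables
    of \<open>f\<close> so that substitution does not alter \<open>f\<close> itself.\<close>
  let ?A = "A \<union> tm_fv f \<union> {x, y, z}"
  note sF = F[unfolded subst_stable_def, rule_format]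
  have "ap \<Gamma> (ap \<Gamma> (ap \<Gamma> f a) b) c = nf \<Gamma> (F a b c)"
    if "ctx \<Gamma>" "tm_type a = Some S1" "tm_type b = Some S2" "tm_type c = Some S3" for \<Gamma> a b c
  proof -
    interpret ctx \<Gamma> by fact
    have "nf \<Gamma> (f \<cdot> a \<cdot> b \<cdot> c) = nf \<Gamma> (F a b c)"
    proof (rule eq_generalize[where F = "\<lambda>a b c d. f \<cdot> a \<cdot> b \<cdot> c" and G = "\<lambda>a b c d. F a b c"
          and A = ?A and d = "Con CZero"])
      show "subst_stable ?A (\<lambda>a b c d. F a b c)" using F by (auto simp: subst_stable_def)
      show "subst_stable ?A (\<lambda>a b c d. f \<cdot> a \<cdot> b \<cdot> c)" by (auto simp: subst_stable_def)
      show "finite ?A" using A by simp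
      fix x' y' z' w :: var
      assume a: "snd x' = S1" "snd y' = S2" "snd z' = S3" "snd w = TNat"
        "\<forall>v\<in>?A. x' \<noteq> v \<and> y' \<noteq> v \<and> z' \<noteq> v \<and> w \<noteq> v"
        "x' \<noteq> y'" "x' \<noteq> z'" "y' \<noteq> z'"
      have ff: "tm_free_for s v (F (Var a) (Var b) (Var c))" if "v \<notin> A" for s v a b c
        using sF[OF that, of s "Var a" "Var b" "Var c" "Con CZero"] by simp
      have ne: "x' \<noteq> x" "x' \<noteq> y" "x' \<noteq> z" "y' \<noteq> y" "y' \<noteq> z" "z' \<noteq> z" using a by auto
      have sub: "tm_subst v s (F (Var a) (Var b) (Var c))
        = F (tm_subst v s (Var a)) (tm_subst v s (Var b)) (tm_subst v s (Var c))"
        if "v \<notin> A" for s v a b c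
        using sF[OF that, of s "Var a" "Var b" "Var c" "Con CZero"] by simp
      have 1: "ap \<Gamma> f (Var x') = nf \<Gamma> (Lam y (Lam z (F (Var x') (Var y) (Var z))))"
        using a x y z ne ty ff sub by (simp add: f_def)
      have 2: "ap \<Gamma> (Lam y (Lam z (F (Var x') (Var y) (Var z)))) (Var y')
        = nf \<Gamma> (Lam z (F (Var x') (Var y') (Var z)))"
        using a x y z ne ty ff sub by simp
      have 3: "ap \<Gamma> (Lam z (F (Var x') (Var y') (Var z))) (Var z') = nf \<Gamma> (F (Var x') (Var y') (Var z'))"
        using a x y z ne ty ff sub by simp
      show "nf \<Gamma> (f \<cdot> Var x' \<cdot> Var y' \<cdot> Var z') = nf \<Gamma> (F (Var x') (Var y') (Var z')) \<and>
        tm_type (f \<cdot> Var x' \<cdot> Var y' \<cdot> Var z') \<noteq> None"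
        using a tf by (simp add: 1 2 3)
    qed (use that in auto)
    then show ?thesis by simp
  qed
  with tf show ?thesis by (rule that)
qed

section \<open>The operations on sequences\<close>

lemma tm_fv_closed [simp]:
  "tm_fv pred = {}" "tm_fv monus = {}" "tm_fv (cons X) = {}" "tm_fv (conc X) = {}"
  "tm_fv (init X) = {}" "tm_fv (qsub X R) = {}" "tm_fv (ovl X R) = {}"
  by (auto simp: pred_def monus_def cons_def conc_def init_def qsub_def ovl_def Let_def)

lemma tm_type_closed [simp]:
  "tm_type pred = Some (TNat \<rightarrow> TNat)"
  "tm_type monus = Some (TNat \<rightarrow> TNat \<rightarrow> TNat)"
  "tm_type (cons X) = Some (X \<rightarrow> TInf X \<rightarrow> TInf X)"
  "tm_type (conc X) = Some (TSeq X \<rightarrow> TInf X \<rightarrow> TInf X)"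
  "tm_type (init X) = Some (TInf X \<rightarrow> TNat \<rightarrow> TSeq X)"
  "tm_type (qsub X R) = Some ((TInf X \<rightarrow> R) \<rightarrow> TSeq X \<rightarrow> TInf X \<rightarrow> R)"
  "tm_type (ovl X R) = Some (TSel R X \<rightarrow> (X \<rightarrow> R) \<rightarrow> R)"
  by (auto simp: pred_def monus_def cons_def conc_def init_def qsub_def ovl_def Let_def)

declare suc_def [simp] sing_def [simp]

context ctx
begin

section \<open>Computation rules of the closed operations\<close>

lemma ap_pred_0 [simp]: "ap \<Gamma> pred (Con CZero) = nf \<Gamma> (Con CZero)"
  by (simp add: pred_def Let_def)

lemma ap_pred_Suc [simp]:
  assumes "tm_type t = Some TNat"
  shows "ap \<Gamma> pred (ap \<Gamma> (Con CSuc) t) = nf \<Gamma> t"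
proof -
  have "nf \<Gamma> (pred \<cdot> (Con CSuc \<cdot> t)) = nf \<Gamma> t"
    \<comment> \<open>Here and in the rules below, \<open>A\<close> collects the variables bound in
      the defining term; generic arguments outside \<open>A\<close> allow plain unfolding and
      \<beta>-reduction.\<close>
    by (rule eq_generalize[where F = "\<lambda>a b c d. pred \<cdot> (Con CSuc \<cdot> a)" and G = "\<lambda>a b c d. a"
          and A = "{(''m'', TNat), (''i'', TNat), (''k'', TNat)}"
          and b = "Con CZero" and c = "Con CZero" and d = "Con CZero"])
      (simp_all add: subst_stable_def assms, simp add: pred_def Let_def)
  then show ?thesis by simp
qed

lemma ap_monus_0 [simp]:
  assumes "tm_type m = Some TNat"
  shows "ap \<Gamma> (ap \<Gamma> monus m) (Con CZero) = nf \<Gamma> m"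
proof -
  have "nf \<Gamma> (monus \<cdot> m \<cdot> Con CZero) = nf \<Gamma> m"
    by (rule eq_generalize[where F = "\<lambda>a b c d. monus \<cdot> a \<cdot> Con CZero" and G = "\<lambda>a b c d. a"
          and A = "{(''m'', TNat), (''n'', TNat), (''i'', TNat), (''k'', TNat)}"
          and b = "Con CZero" and c = "Con CZero" and d = "Con CZero"])
      (simp_all add: subst_stable_def assms, simp add: monus_def Let_def)
  then show ?thesis by simp
qed

lemma ap_monus_Suc:
  assumes "tm_type m = Some TNat" "tm_type n = Some TNat"
  shows "ap \<Gamma> (ap \<Gamma> monus m) (ap \<Gamma> (Con CSuc) n) = ap \<Gamma> pred (ap \<Gamma> (ap \<Gamma> monus m) n)"
proof -
  have "nf \<Gamma> (monus \<cdot> m \<cdot> (Con CSuc \<cdot> n)) = nf \<Gamma> (pred \<cdot> (monus \<cdot> m \<cdot> n))"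
    by (rule eq_generalize[where F = "\<lambda>a b c d. monus \<cdot> a \<cdot> (Con CSuc \<cdot> b)"
          and G = "\<lambda>a b c d. pred \<cdot> (monus \<cdot> a \<cdot> b)"
          and A = "{(''m'', TNat), (''n'', TNat), (''i'', TNat), (''k'', TNat)}"
          and c = "Con CZero" and d = "Con CZero"])
      (simp_all add: subst_stable_def assms, simp add: monus_def Let_def)
  then show ?thesis by simp
qed

lemma ap_cons_0 [simp]:
  assumes "tm_type x = Some X" "tm_type b = Some (TInf X)"
  shows "ap \<Gamma> (ap \<Gamma> (ap \<Gamma> (cons X) x) b) (Con CZero) = nf \<Gamma> x"
proof -
  have "nf \<Gamma> (cons X \<cdot> x \<cdot> b \<cdot> Con CZero) = nf \<Gamma> x"
    by (rule eq_generalize[where F = "\<lambda>a b c d. cons X \<cdot> a \<cdot> b \<cdot> Con CZero" and G = "\<lambda>a b c d. a"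
          and A = "{(''x'', X), (''b'', TInf X), (''i'', TNat), (''j'', TNat), (''y'', X)}"
          and c = "Con CZero" and d = "Con CZero"])
      (simp_all add: subst_stable_def assms, simp add: cons_def Let_def)
  then show ?thesis by simp
qed

lemma ap_cons_Suc [simp]:
  assumes "tm_type x = Some X" "tm_type b = Some (TInf X)" "tm_type i = Some TNat"
  shows "ap \<Gamma> (ap \<Gamma> (ap \<Gamma> (cons X) x) b) (ap \<Gamma> (Con CSuc) i) = ap \<Gamma> b i"
proof -
  have "nf \<Gamma> (cons X \<cdot> x \<cdot> b \<cdot> (Con CSuc \<cdot> i)) = nf \<Gamma> (b \<cdot> i)"
    by (rule eq_generalize[where F = "\<lambda>a b c d. cons X \<cdot> a \<cdot> b \<cdot> (Con CSuc \<cdot> c)"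
          and G = "\<lambda>a b c d. b \<cdot> c"
          and A = "{(''x'', X), (''b'', TInf X), (''i'', TNat), (''j'', TNat), (''y'', X)}"
          and d = "Con CZero"])
      (simp_all add: subst_stable_def assms, simp add: cons_def Let_def)
  then show ?thesis by simp
qed

lemma ap_conc_Empty [simp]:
  assumes "tm_type b = Some (TInf X)"
  shows "ap \<Gamma> (ap \<Gamma> (conc X) (Con (CEmpty X))) b = nf \<Gamma> b"
  using assms by (simp add: conc_def Let_def)

lemma ap_conc_Snoc [simp]:
  assumes "tm_type s = Some (TSeq X)" "tm_type x = Some X" "tm_type b = Some (TInf X)"
  shows "ap \<Gamma> (ap \<Gamma> (conc X) (ap \<Gamma> (ap \<Gamma> (Con (CSnoc X)) s) x)) b
    = ap \<Gamma> (ap \<Gamma> (conc X) s) (ap \<Gamma> (ap \<Gamma> (cons X) x) b)"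
proof -
  let ?x = "(''x'', X)" and ?s = "(''s'', TSeq X)" and ?b = "(''b'', TInf X)"
    and ?f = "(''f'', TInf X \<rightarrow> TInf X)"
  define step where
    "step = Lam ?s (Lam ?x (Lam ?f (Lam ?b (Var ?f \<cdot> (cons X \<cdot> Var ?x \<cdot> Var ?b)))))"
  have [simp]: "tm_fv step = {}" by (auto simp: step_def)
  have [simp]: "tm_type step = Some (TSeq X \<rightarrow> X \<rightarrow> (TInf X \<rightarrow> TInf X) \<rightarrow> TInf X \<rightarrow> TInf X)"
    by (simp add: step_def)
  \<comment> \<open>The recursive value \<open>conc X \<cdot> s\<close> is treated as a generic
    third argument, so that reducing \<open>step\<close> never opens \<open>conc\<close>
    itself.\<close>
  have "nf \<Gamma> (step \<cdot> s \<cdot> x \<cdot> (conc X \<cdot> s) \<cdot> b) = nf \<Gamma> (conc X \<cdot> s \<cdot> (cons X \<cdot> x \<cdot> b))"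
    by (rule eq_generalize[where F = "\<lambda>a b c d. step \<cdot> a \<cdot> b \<cdot> c \<cdot> d"
          and G = "\<lambda>a b c d. c \<cdot> (cons X \<cdot> b \<cdot> d)" and A = "{?x, ?s, ?b, ?f}"])
      (simp_all add: subst_stable_def assms, simp add: step_def)
  moreover have "ap \<Gamma> (conc X) (ap \<Gamma> (ap \<Gamma> (Con (CSnoc X)) s) x)
    = ap \<Gamma> (ap \<Gamma> (ap \<Gamma> step s) x) (ap \<Gamma> (conc X) s)"
    using assms by (simp add: conc_def Let_def step_def[symmetric])
  ultimately show ?thesis by simp
qed

lemma ap_init_0 [simp]:
  assumes "tm_type a = Some (TInf X)"
  shows "ap \<Gamma> (ap \<Gamma> (init X) a) (Con CZero) = nf \<Gamma> (Con (CEmpty X))"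
proof -
  have "nf \<Gamma> (init X \<cdot> a \<cdot> Con CZero) = nf \<Gamma> (Con (CEmpty X))"
    by (rule eq_generalize[where F = "\<lambda>a b c d. init X \<cdot> a \<cdot> Con CZero"
          and G = "\<lambda>a b c d. Con (CEmpty X)"
          and A = "{(''a'', TInf X), (''n'', TNat), (''i'', TNat), (''s'', TSeq X)}"
          and b = "Con CZero" and c = "Con CZero" and d = "Con CZero"])
      (simp_all add: subst_stable_def assms, simp add: init_def Let_def)
  then show ?thesis by simp
qed

lemma ap_init_Suc [simp]:
  assumes "tm_type a = Some (TInf X)" "tm_type n = Some TNat"
  shows "ap \<Gamma> (ap \<Gamma> (init X) a) (ap \<Gamma> (Con CSuc) n)
    = ap \<Gamma> (ap \<Gamma> (Con (CSnoc X)) (ap \<Gamma> (ap \<Gamma> (init X) a) n)) (ap \<Gamma> a n)"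
proof -
  have "nf \<Gamma> (init X \<cdot> a \<cdot> (Con CSuc \<cdot> n)) = nf \<Gamma> (Con (CSnoc X) \<cdot> (init X \<cdot> a \<cdot> n) \<cdot> (a \<cdot> n))"
    by (rule eq_generalize[where F = "\<lambda>a b c d. init X \<cdot> a \<cdot> (Con CSuc \<cdot> b)"
          and G = "\<lambda>a b c d. Con (CSnoc X) \<cdot> (init X \<cdot> a \<cdot> b) \<cdot> (a \<cdot> b)"
          and A = "{(''a'', TInf X), (''n'', TNat), (''i'', TNat), (''s'', TSeq X)}"
          and c = "Con CZero" and d = "Con CZero"])
      (simp_all add: subst_stable_def assms, simp add: init_def Let_def)
  then show ?thesis by simp
qed

lemma ap_qsub [simp]:
  assumes "tm_type q = Some (TInf X \<rightarrow> R)" "tm_type s = Some (TSeq X)" "tm_type b = Some (TInf X)"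
  shows "ap \<Gamma> (ap \<Gamma> (ap \<Gamma> (qsub X R) q) s) b = ap \<Gamma> q (ap \<Gamma> (ap \<Gamma> (conc X) s) b)"
proof -
  have "nf \<Gamma> (qsub X R \<cdot> q \<cdot> s \<cdot> b) = nf \<Gamma> (q \<cdot> (conc X \<cdot> s \<cdot> b))"
    by (rule eq_generalize[where F = "\<lambda>a b c d. qsub X R \<cdot> a \<cdot> b \<cdot> c"
          and G = "\<lambda>a b c d. a \<cdot> (conc X \<cdot> b \<cdot> c)"
          and A = "{(''q'', TInf X \<rightarrow> R), (''s'', TSeq X), (''b'', TInf X)}"
          and d = "Con CZero"])
      (simp_all add: subst_stable_def assms, simp add: qsub_def Let_def)
  then show ?thesis by simp
qed

lemma ap_ovl [simp]:
  assumes "tm_type d = Some (TSel R X)" "tm_type p = Some (X \<rightarrow> R)"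
  shows "ap \<Gamma> (ap \<Gamma> (ovl X R) d) p = ap \<Gamma> p (ap \<Gamma> d p)"
proof -
  have "nf \<Gamma> (ovl X R \<cdot> d \<cdot> p) = nf \<Gamma> (p \<cdot> (d \<cdot> p))"
    by (rule eq_generalize[where F = "\<lambda>a b c d. ovl X R \<cdot> a \<cdot> b"
          and G = "\<lambda>a b c d. b \<cdot> (a \<cdot> b)"
          and A = "{(''d'', TSel R X), (''p'', X \<rightarrow> R)}"
          and c = "Con CZero" and d = "Con CZero"])
      (simp_all add: subst_stable_def assms, simp add: ovl_def Let_def)
  then show ?thesis by simp
qed

section \<open>The zero sequence and the order on numbers\<close>

lemma cons_zero [simp]:
  "ap \<Gamma> (ap \<Gamma> (cons X) (zero X)) (zero (TInf X)) = nf \<Gamma> (zero (TInf X))"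
proof -
  have "nf \<Gamma> (cons X \<cdot> zero X \<cdot> zero (TInf X)) = nf \<Gamma> (zero (TInf X))"
  \<comment> \<open>The sequences are compared entry by entry: at 0 and at every successor both
    sides compute to the zero of \<open>X\<close>.\<close>
  proof (rule nf_nat_ext[where A = "{}"])
    fix y :: var and \<Delta>
    assume "snd y = TNat" "ctx \<Delta>"
    then interpret \<Delta>: ctx \<Delta> by simp
    show "ap \<Delta> (cons X \<cdot> zero X \<cdot> zero (TInf X)) (ap \<Delta> (Con CSuc) (Var y))
      = ap \<Delta> (zero (TInf X)) (ap \<Delta> (Con CSuc) (Var y))"
      using \<open>snd y = TNat\<close> by simp
  qed auto
  then show ?thesis by simp
qed

text \<open>Truncated difference recurses on its second argument, so this takes an induction; the
  successor case is the predecessor of 0.\<close>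

lemma monus_zero_left [simp]:
  assumes "tm_type n = Some TNat"
  shows "ap \<Gamma> (ap \<Gamma> monus (Con CZero)) n = nf \<Gamma> (Con CZero)"
proof -
  have "nf \<Gamma> (monus \<cdot> Con CZero) = nf \<Gamma> (zero (TNat \<rightarrow> TNat))"
  proof (rule nf_nat_ext[where A = "{}"])
    fix y :: var and \<Delta>
    assume y: "snd y = TNat" and "ctx \<Delta>"
      and IH: "(monus \<cdot> Con CZero \<cdot> Var y \<^bold>= zero (TNat \<rightarrow> TNat) \<cdot> Var y) \<in> \<Delta>"
    then interpret \<Delta>: ctx \<Delta> by simp
    show "ap \<Delta> (monus \<cdot> Con CZero) (ap \<Delta> (Con CSuc) (Var y))
      = ap \<Delta> (zero (TNat \<rightarrow> TNat)) (ap \<Delta> (Con CSuc) (Var y))"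
      using ap_hyp[OF IH] y by (simp add: \<Delta>.ap_monus_Suc)
  qed auto
  from ap_cong[OF this, of n] show ?thesis using assms by simp
qed

text \<open>Induction on \<open>n\<close> with \<open>m\<close> fixed. At 0 the left side is the
  predecessor of \<open>m + 1\<close>; at a successor both sides are predecessors of the two sides
  before.\<close>

lemma monus_Suc_Suc:
  assumes m: "tm_type m = Some TNat" and n: "tm_type n = Some TNat"
  shows "ap \<Gamma> (ap \<Gamma> monus (ap \<Gamma> (Con CSuc) m)) (ap \<Gamma> (Con CSuc) n) = ap \<Gamma> (ap \<Gamma> monus m) n"
proof -
  obtain f where f: "tm_type f = Some (TNat \<rightarrow> TNat \<rightarrow> TNat \<rightarrow> TNat)"
    "\<And>\<Delta> a b c. ctx \<Delta> \<Longrightarrow> tm_type a = Some TNat \<Longrightarrow> tm_type b = Some TNat \<Longrightarrow> tm_type c = Some TNat \<Longrightarrow>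
      ap \<Delta> (ap \<Delta> (ap \<Delta> f a) b) c = nf \<Delta> (monus \<cdot> (Con CSuc \<cdot> m) \<cdot> (Con CSuc \<cdot> c))"
    by (rule combinatory_completeness[where F = "\<lambda>a b c. monus \<cdot> (Con CSuc \<cdot> m) \<cdot> (Con CSuc \<cdot> c)"
          and A = "tm_fv m" and ?S1.0 = TNat and ?S2.0 = TNat and ?S3.0 = TNat and T = TNat])
      (use m in \<open>auto simp: subst_stable_def\<close>)
  have "nf \<Gamma> (f \<cdot> Con CZero \<cdot> Con CZero) = nf \<Gamma> (monus \<cdot> m)"
  proof (rule nf_nat_ext[where A = "{}"])
    show "ap \<Gamma> (f \<cdot> Con CZero \<cdot> Con CZero) (Con CZero) = ap \<Gamma> (monus \<cdot> m) (Con CZero)"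
      using m f ctx_axioms by (simp add: ap_monus_Suc)
    fix y :: var and \<Delta>
    assume y: "snd y = TNat" and "ctx \<Delta>"
      and IH: "(f \<cdot> Con CZero \<cdot> Con CZero \<cdot> Var y \<^bold>= monus \<cdot> m \<cdot> Var y) \<in> \<Delta>"
    then interpret \<Delta>: ctx \<Delta> by simp
    show "ap \<Delta> (f \<cdot> Con CZero \<cdot> Con CZero) (ap \<Delta> (Con CSuc) (Var y))
      = ap \<Delta> (monus \<cdot> m) (ap \<Delta> (Con CSuc) (Var y))"
      using ap_hyp[OF IH] y m f \<open>ctx \<Delta>\<close> by (simp add: \<Delta>.ap_monus_Suc)
  qed (use f m in auto)
  from ap_cong[OF this, of n] show ?thesis using f m n ctx_axioms by simp
qed

text \<open>
  The term \<open>nz\<close> is \<open>1\<close> when both arguments vanish; that \<open>nz (m + 1 - n) (n - m)\<close> is \<open>0\<close>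
  for truncated differences is provable by a purely equational induction on \<open>n\<close>.
\<close>

lemma monus_contradiction:
  assumes m: "tm_type m = Some TNat" and n: "tm_type n = Some TNat"
    and le: "ap \<Gamma> (ap \<Gamma> monus n) m = nf \<Gamma> (Con CZero)"
    and less: "ap \<Gamma> (ap \<Gamma> monus (ap \<Gamma> (Con CSuc) m)) n = nf \<Gamma> (Con CZero)"
  shows "\<Gamma> \<turnstile> Fls"
proof -
  let ?Z = "Con CZero" and ?S = "Con CSuc" and ?K = "zero (TNat \<rightarrow> TNat \<rightarrow> TNat)"
  obtain nz where nz: "tm_type nz = Some (TNat \<rightarrow> TNat \<rightarrow> TNat \<rightarrow> TNat)"
    "\<And>\<Delta> a b c. ctx \<Delta> \<Longrightarrow> tm_type a = Some TNat \<Longrightarrow> tm_type b = Some TNat \<Longrightarrow> tm_type c = Some TNat \<Longrightarrow>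
      ap \<Delta> (ap \<Delta> (ap \<Delta> nz a) b) c
        = nf \<Delta> (Con (CRec TNat) \<cdot> (Con (CRec TNat) \<cdot> (?S \<cdot> ?Z) \<cdot> ?K \<cdot> b) \<cdot> ?K \<cdot> c)"
    by (rule combinatory_completeness[where ?S1.0 = TNat and ?S2.0 = TNat and ?S3.0 = TNat and T = TNat
          and F = "\<lambda>a b c. Con (CRec TNat) \<cdot> (Con (CRec TNat) \<cdot> (?S \<cdot> ?Z) \<cdot> ?K \<cdot> b) \<cdot> ?K \<cdot> c"
          and A = "{}"])
      (auto simp: subst_stable_def)
  obtain f where f: "tm_type f = Some (TNat \<rightarrow> TNat \<rightarrow> TNat \<rightarrow> TNat)"
    "\<And>\<Delta> a b c. ctx \<Delta> \<Longrightarrow> tm_type a = Some TNat \<Longrightarrow> tm_type b = Some TNat \<Longrightarrow> tm_type c = Some TNat \<Longrightarrow>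
      ap \<Delta> (ap \<Delta> (ap \<Delta> f a) b) c = nf \<Delta> (nz \<cdot> ?Z \<cdot> (monus \<cdot> (?S \<cdot> c) \<cdot> b) \<cdot> (monus \<cdot> b \<cdot> c))"
    by (rule combinatory_completeness[where ?S1.0 = TNat and ?S2.0 = TNat and ?S3.0 = TNat and T = TNat
          and F = "\<lambda>a b c. nz \<cdot> ?Z \<cdot> (monus \<cdot> (?S \<cdot> c) \<cdot> b) \<cdot> (monus \<cdot> b \<cdot> c)" and A = "tm_fv nz"])
      (use nz(1) in \<open>auto simp: subst_stable_def\<close>)
  \<comment> \<open>Values at \<open>n\<close> are compared as functions of \<open>m\<close>, so the
    induction hypothesis covers all \<open>m\<close>. In the successor case \<open>m\<close> is
    split into 0 and a successor, and \<open>monus_Suc_Suc\<close> reduces the pair of successors to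
    the hypothesis.\<close>
  have "nf \<Gamma> (f \<cdot> ?Z) = nf \<Gamma> ?K"
  proof (rule nf_nat_ext[where A = "{}"])
    have "nf \<Gamma> (f \<cdot> ?Z \<cdot> ?Z) = nf \<Gamma> (zero (TNat \<rightarrow> TNat))"
      by (rule nf_ext) (use f nz ctx_axioms in auto)
    then show "ap \<Gamma> (f \<cdot> ?Z) ?Z = ap \<Gamma> ?K ?Z" by simp
    fix y :: var and \<Delta>
    assume y: "snd y = TNat" and "ctx \<Delta>"
      and IH: "(f \<cdot> ?Z \<cdot> Var y \<^bold>= ?K \<cdot> Var y) \<in> \<Delta>"
    then interpret \<Delta>: ctx \<Delta> by simp
    have "nf \<Delta> (f \<cdot> ?Z \<cdot> (?S \<cdot> Var y)) = nf \<Delta> (zero (TNat \<rightarrow> TNat))"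
    proof (rule \<Delta>.nf_nat_ext[where A = "{}"])
      show "ap \<Delta> (f \<cdot> ?Z \<cdot> (?S \<cdot> Var y)) ?Z = ap \<Delta> (zero (TNat \<rightarrow> TNat)) ?Z"
        using f nz y \<open>ctx \<Delta>\<close> by (simp add: \<Delta>.monus_Suc_Suc)
      fix z :: var and \<Theta>
      assume z: "snd z = TNat" and "ctx \<Theta>" "\<Delta> \<subseteq> \<Theta>"
      then interpret \<Theta>: ctx \<Theta> by simp
      have "ap \<Theta> (f \<cdot> ?Z) (Var y) = ap \<Theta> ?K (Var y)"
        using ap_hyp[OF subsetD[OF \<open>\<Delta> \<subseteq> \<Theta>\<close> IH]] f y by simp
      then have "ap \<Theta> (ap \<Theta> (f \<cdot> ?Z) (Var y)) (Var z) = ap \<Theta> (ap \<Theta> ?K (Var y)) (Var z)" by simp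
      then show "ap \<Theta> (f \<cdot> ?Z \<cdot> (?S \<cdot> Var y)) (ap \<Theta> ?S (Var z))
        = ap \<Theta> (zero (TNat \<rightarrow> TNat)) (ap \<Theta> ?S (Var z))"
        using f nz y z \<open>ctx \<Theta>\<close> by (simp add: \<Theta>.monus_Suc_Suc)
    qed (use f y in auto)
    then show "ap \<Delta> (f \<cdot> ?Z) (ap \<Delta> ?S (Var y)) = ap \<Delta> ?K (ap \<Delta> ?S (Var y))"
      using y by simp
  qed (use f in auto)
  then have "ap \<Gamma> (ap \<Gamma> (f \<cdot> ?Z) n) m = ap \<Gamma> (ap \<Gamma> ?K n) m"
    using ap_cong by metis
  \<comment> \<open>By \<open>le\<close> and \<open>less\<close> both differences are 0, so the left
    side evaluates to 1.\<close>
  then have "nf \<Gamma> (?S \<cdot> ?Z) = nf \<Gamma> ?Z"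
    using f nz m n le less ctx_axioms by simp
  then have "\<Gamma> \<turnstile> ?S \<cdot> ?Z \<^bold>= ?Z" by (rule nf_eqD) simp
  moreover have "\<Gamma> \<turnstile> Neg (?S \<cdot> ?Z \<^bold>= ?Z)" by (rule ax, rule suc_not_zero) simp
  ultimately show ?thesis using ImpE by blast
qed

text \<open>Both sides are the first \<open>n + 1\<close> entries of \<open>b\<close> followed by
  \<open>c\<close>: on the left the last of these entries is split off, on the right the first. This
  mediates between \<open>conc\<close>, which consumes a finite sequence from its right end, and
  indexing, which counts from the left. In the induction on \<open>n\<close> the hypothesis is used
  with one more entry in front of \<open>c\<close>.\<close>

lemma conc_init_shift:
  assumes tail: "tm_type tail = Some (TInf X \<rightarrow> TInf X)"
    "\<And>\<Delta> b j. ctx \<Delta> \<Longrightarrow> tm_type b = Some (TInf X) \<Longrightarrow> tm_type j = Some TNat \<Longrightarrow>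
      ap \<Delta> (ap \<Delta> tail b) j = ap \<Delta> b (ap \<Delta> (Con CSuc) j)"
    and ty: "tm_type n = Some TNat" "tm_type b = Some (TInf X)" "tm_type c = Some (TInf X)"
  shows "ap \<Gamma> (ap \<Gamma> (conc X) (ap \<Gamma> (ap \<Gamma> (init X) b) n)) (ap \<Gamma> (ap \<Gamma> (cons X) (ap \<Gamma> b n)) c)
    = ap \<Gamma> (ap \<Gamma> (cons X) (ap \<Gamma> b (Con CZero)))
        (ap \<Gamma> (ap \<Gamma> (conc X) (ap \<Gamma> (ap \<Gamma> (init X) (ap \<Gamma> tail b)) n)) c)"
proof -
  obtain f where f: "tm_type f = Some (TNat \<rightarrow> TInf X \<rightarrow> TInf X \<rightarrow> TInf X)"
    "\<And>\<Delta> n b c. ctx \<Delta> \<Longrightarrow> tm_type n = Some TNat \<Longrightarrow> tm_type b = Some (TInf X) \<Longrightarrow>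
      tm_type c = Some (TInf X) \<Longrightarrow>
      ap \<Delta> (ap \<Delta> (ap \<Delta> f n) b) c = nf \<Delta> (conc X \<cdot> (init X \<cdot> b \<cdot> n) \<cdot> (cons X \<cdot> (b \<cdot> n) \<cdot> c))"
    by (rule combinatory_completeness[where F = "\<lambda>n b c. conc X \<cdot> (init X \<cdot> b \<cdot> n) \<cdot> (cons X \<cdot> (b \<cdot> n) \<cdot> c)"
          and A = "{}" and ?S1.0 = TNat and ?S2.0 = "TInf X" and ?S3.0 = "TInf X" and T = "TInf X"])
      (auto simp: subst_stable_def)
  obtain g where g: "tm_type g = Some (TNat \<rightarrow> TInf X \<rightarrow> TInf X \<rightarrow> TInf X)"
    "\<And>\<Delta> n b c. ctx \<Delta> \<Longrightarrow> tm_type n = Some TNat \<Longrightarrow> tm_type b = Some (TInf X) \<Longrightarrow>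
      tm_type c = Some (TInf X) \<Longrightarrow>
      ap \<Delta> (ap \<Delta> (ap \<Delta> g n) b) c
        = nf \<Delta> (cons X \<cdot> (b \<cdot> Con CZero) \<cdot> (conc X \<cdot> (init X \<cdot> (tail \<cdot> b) \<cdot> n) \<cdot> c))"
    by (rule combinatory_completeness[where
          F = "\<lambda>n b c. cons X \<cdot> (b \<cdot> Con CZero) \<cdot> (conc X \<cdot> (init X \<cdot> (tail \<cdot> b) \<cdot> n) \<cdot> c)"
          and A = "tm_fv tail" and ?S1.0 = TNat and ?S2.0 = "TInf X" and ?S3.0 = "TInf X" and T = "TInf X"])
      (use tail(1) in \<open>auto simp: subst_stable_def\<close>)
  have "nf \<Gamma> f = nf \<Gamma> g"
  proof (rule nf_nat_ext[where A = "{}"])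
    have "nf \<Gamma> (f \<cdot> Con CZero) = nf \<Gamma> (g \<cdot> Con CZero)"
      by (rule nf_ext2) (use f g tail ctx_axioms in auto)
    then show "ap \<Gamma> f (Con CZero) = ap \<Gamma> g (Con CZero)" by simp
    fix y :: var and \<Delta>
    assume y: "snd y = TNat" and "ctx \<Delta>" and IH: "(f \<cdot> Var y \<^bold>= g \<cdot> Var y) \<in> \<Delta>"
    then interpret \<Delta>: ctx \<Delta> by simp
    have *: "ap \<Delta> (ap \<Delta> (conc X) (ap \<Delta> (ap \<Delta> (init X) b) (Var y))) (ap \<Delta> (ap \<Delta> (cons X) (ap \<Delta> b (Var y))) c)
      = ap \<Delta> (ap \<Delta> (cons X) (ap \<Delta> b (Con CZero)))
        (ap \<Delta> (ap \<Delta> (conc X) (ap \<Delta> (ap \<Delta> (init X) (ap \<Delta> tail b)) (Var y))) c)"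
      if "tm_type b = Some (TInf X)" "tm_type c = Some (TInf X)" for b c
    proof -
      have "ap \<Delta> f (Var y) = ap \<Delta> g (Var y)" using ap_hyp[OF IH] f g y by simp
      then have "ap \<Delta> (ap \<Delta> (ap \<Delta> f (Var y)) b) c = ap \<Delta> (ap \<Delta> (ap \<Delta> g (Var y)) b) c" by simp
      then show ?thesis using f(2) g(2) y \<open>ctx \<Delta>\<close> that by simp
    qed
    have "nf \<Delta> (f \<cdot> (Con CSuc \<cdot> Var y)) = nf \<Delta> (g \<cdot> (Con CSuc \<cdot> Var y))"
      by (rule \<Delta>.nf_ext2) (use f g tail y \<open>ctx \<Delta>\<close> in \<open>auto simp: *\<close>)
    then show "ap \<Delta> f (ap \<Delta> (Con CSuc) (Var y)) = ap \<Delta> g (ap \<Delta> (Con CSuc) (Var y))" by simp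
  qed (use f g in auto)
  then have "ap \<Gamma> (ap \<Gamma> (ap \<Gamma> f n) b) c = ap \<Gamma> (ap \<Gamma> (ap \<Gamma> g n) b) c"
    using ap_cong by metis
  then show ?thesis using f(2) g(2) ty ctx_axioms by simp
qed

text \<open>Induction on \<open>n\<close> for all \<open>b\<close> at once:
  \<open>conc_init_shift\<close> exposes the first entry, index \<open>n + 1\<close> skips it, and
  the hypothesis applies to the tail of \<open>b\<close>.\<close>

lemma conc_init_nth:
  assumes ty: "tm_type n = Some TNat" "tm_type b = Some (TInf X)" "tm_type c = Some (TInf X)"
  shows "ap \<Gamma> (ap \<Gamma> (ap \<Gamma> (conc X) (ap \<Gamma> (ap \<Gamma> (init X) b) n)) c) n = ap \<Gamma> c (Con CZero)"
proof -
  obtain t where t: "tm_type t = Some (TNat \<rightarrow> TInf X \<rightarrow> TNat \<rightarrow> X)"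
    "\<And>\<Delta> a b c. ctx \<Delta> \<Longrightarrow> tm_type a = Some TNat \<Longrightarrow> tm_type b = Some (TInf X) \<Longrightarrow> tm_type c = Some TNat \<Longrightarrow>
      ap \<Delta> (ap \<Delta> (ap \<Delta> t a) b) c = nf \<Delta> (b \<cdot> (Con CSuc \<cdot> c))"
    by (rule combinatory_completeness[where F = "\<lambda>a b c. b \<cdot> (Con CSuc \<cdot> c)"
          and A = "{}" and ?S1.0 = TNat and ?S2.0 = "TInf X" and ?S3.0 = TNat and T = X])
      (auto simp: subst_stable_def)
  \<comment> \<open>Removal of the first entry; the leading slot of \<open>t\<close> receives a
    default number.\<close>
  define tail where "tail = t \<cdot> Con CZero"
  have tail: "tm_type tail = Some (TInf X \<rightarrow> TInf X)"
    "\<And>\<Delta> b j. ctx \<Delta> \<Longrightarrow> tm_type b = Some (TInf X) \<Longrightarrow> tm_type j = Some TNat \<Longrightarrow>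
      ap \<Delta> (ap \<Delta> tail b) j = ap \<Delta> b (ap \<Delta> (Con CSuc) j)"
    using t by (auto simp: tail_def)
  obtain f where f: "tm_type f = Some (TNat \<rightarrow> TInf X \<rightarrow> TInf X \<rightarrow> X)"
    "\<And>\<Delta> n b c. ctx \<Delta> \<Longrightarrow> tm_type n = Some TNat \<Longrightarrow> tm_type b = Some (TInf X) \<Longrightarrow>
      tm_type c = Some (TInf X) \<Longrightarrow>
      ap \<Delta> (ap \<Delta> (ap \<Delta> f n) b) c = nf \<Delta> (conc X \<cdot> (init X \<cdot> b \<cdot> n) \<cdot> c \<cdot> n)"
    by (rule combinatory_completeness[where F = "\<lambda>n b c. conc X \<cdot> (init X \<cdot> b \<cdot> n) \<cdot> c \<cdot> n"
          and A = "{}" and ?S1.0 = TNat and ?S2.0 = "TInf X" and ?S3.0 = "TInf X" and T = X])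
      (auto simp: subst_stable_def)
  obtain g where g: "tm_type g = Some (TNat \<rightarrow> TInf X \<rightarrow> TInf X \<rightarrow> X)"
    "\<And>\<Delta> n b c. ctx \<Delta> \<Longrightarrow> tm_type n = Some TNat \<Longrightarrow> tm_type b = Some (TInf X) \<Longrightarrow>
      tm_type c = Some (TInf X) \<Longrightarrow>
      ap \<Delta> (ap \<Delta> (ap \<Delta> g n) b) c = nf \<Delta> (c \<cdot> Con CZero)"
    by (rule combinatory_completeness[where F = "\<lambda>n b c. c \<cdot> Con CZero"
          and A = "{}" and ?S1.0 = TNat and ?S2.0 = "TInf X" and ?S3.0 = "TInf X" and T = X])
      (auto simp: subst_stable_def)
  have "nf \<Gamma> f = nf \<Gamma> g"
  proof (rule nf_nat_ext[where A = "{}"])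
    have "nf \<Gamma> (f \<cdot> Con CZero) = nf \<Gamma> (g \<cdot> Con CZero)"
      by (rule nf_ext2) (use f g ctx_axioms in auto)
    then show "ap \<Gamma> f (Con CZero) = ap \<Gamma> g (Con CZero)" by simp
    fix y :: var and \<Delta>
    assume y: "snd y = TNat" and "ctx \<Delta>" and IH: "(f \<cdot> Var y \<^bold>= g \<cdot> Var y) \<in> \<Delta>"
    then interpret \<Delta>: ctx \<Delta> by simp
    have *: "ap \<Delta> (ap \<Delta> (ap \<Delta> (conc X) (ap \<Delta> (ap \<Delta> (init X) b) (Var y))) c) (Var y) = ap \<Delta> c (Con CZero)"
      if "tm_type b = Some (TInf X)" "tm_type c = Some (TInf X)" for b c
    proof -
      have "ap \<Delta> f (Var y) = ap \<Delta> g (Var y)" using ap_hyp[OF IH] f g y by simp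
      then have "ap \<Delta> (ap \<Delta> (ap \<Delta> f (Var y)) b) c = ap \<Delta> (ap \<Delta> (ap \<Delta> g (Var y)) b) c" by simp
      then show ?thesis using f(2) g(2) y \<open>ctx \<Delta>\<close> that by simp
    qed
    have "nf \<Delta> (f \<cdot> (Con CSuc \<cdot> Var y)) = nf \<Delta> (g \<cdot> (Con CSuc \<cdot> Var y))"
      by (rule \<Delta>.nf_ext2)
        (use f g tail y \<open>ctx \<Delta>\<close> in \<open>auto simp: * \<Delta>.conc_init_shift[OF tail]\<close>)
    then show "ap \<Delta> f (ap \<Delta> (Con CSuc) (Var y)) = ap \<Delta> g (ap \<Delta> (Con CSuc) (Var y))" by simp
  qed (use f g in auto)
  then have "ap \<Gamma> (ap \<Gamma> (ap \<Gamma> f n) b) c = ap \<Gamma> (ap \<Gamma> (ap \<Gamma> g n) b) c"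
    using ap_cong by metis
  then show ?thesis using f(2) g(2) ty ctx_axioms by simp
qed

text \<open>Extensionality and the recursion of \<open>conc\<close>. It links the iterated
  \<open>(q_s)_x\<close>, produced by the defining equation, to the \<open>q\<close> at longer
  segments in the definition of \<open>p\<close>.\<close>

lemma qsub_snoc:
  assumes "tm_type q = Some (TInf X \<rightarrow> R)" "tm_type s = Some (TSeq X)" "tm_type x = Some X"
  shows "ap \<Gamma> (ap \<Gamma> (qsub X R) (ap \<Gamma> (ap \<Gamma> (qsub X R) q) s))
      (ap \<Gamma> (ap \<Gamma> (Con (CSnoc X)) (Con (CEmpty X))) x)
    = ap \<Gamma> (ap \<Gamma> (qsub X R) q) (ap \<Gamma> (ap \<Gamma> (Con (CSnoc X)) s) x)"
proof -
  have "nf \<Gamma> (qsub X R \<cdot> (qsub X R \<cdot> q \<cdot> s) \<cdot> sing X x) = nf \<Gamma> (qsub X R \<cdot> q \<cdot> (Con (CSnoc X) \<cdot> s \<cdot> x))"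
    by (rule nf_ext) (use assms in auto)
  then show ?thesis by simp
qed

end

section \<open>The functional eps\<close>

text \<open>The names are those bound in \<open>eps_eq\<close>, so \<open>l\<close> and
  \<open>e\<close> are instantiated by themselves and only the index and the functional really
  change.\<close>

abbreviation var_l :: "ty \<Rightarrow> var" where "var_l R \<equiv> (''l'', R \<rightarrow> TNat)"
abbreviation var_e :: "ty \<Rightarrow> ty \<Rightarrow> var" where "var_e X R \<equiv> (''e'', TNat \<rightarrow> TSel R X)"
abbreviation var_q :: "ty \<Rightarrow> ty \<Rightarrow> var" where "var_q X R \<equiv> (''q'', TInf X \<rightarrow> R)"
abbreviation var_n :: var where "var_n \<equiv> (''n'', TNat)"
abbreviation var_x :: "ty \<Rightarrow> var" where "var_x X \<equiv> (''x'', X)"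

abbreviation eps_at :: "ty \<Rightarrow> ty \<Rightarrow> tm \<Rightarrow> tm" where
  "eps_at X R n \<equiv> Con (CEps X R) \<cdot> Var (var_l R) \<cdot> n \<cdot> Var (var_e X R)"

abbreviation eps_arg :: "ty \<Rightarrow> ty \<Rightarrow> tm \<Rightarrow> tm \<Rightarrow> tm" where
  "eps_arg X R n r \<equiv>
     Lam (var_x X) (ovl (TInf X) R \<cdot> eps_at X R (suc n) \<cdot> (qsub X R \<cdot> r \<cdot> sing X (Var (var_x X))))"

abbreviation stop :: "ty \<Rightarrow> ty \<Rightarrow> tm \<Rightarrow> tm \<Rightarrow> fm" where
  "stop X R n r \<equiv> Less (Var (var_l R) \<cdot> (r \<cdot> zero (TInf X))) n"

locale eps_ctx = ctx +
  assumes eps: "eps_axioms \<subseteq> \<Gamma>"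
begin

lemma eps_ctx_insert: "eps_ctx (insert \<phi> \<Gamma>)"
  using ctx_insert eps by (auto simp: eps_ctx_def eps_ctx_axioms_def)

text \<open>The freshness conditions follow the order of the quantifiers: \<open>n\<close> is put in
  below those for \<open>e\<close> and \<open>q\<close> and below the abstraction over
  \<open>x\<close>, whereas \<open>r\<close> is put in last and only has to avoid that
  \<open>x\<close>.\<close>

lemma eps_instance:
  assumes n: "tm_type n = Some TNat" "var_e X R \<notin> tm_fv n" "var_q X R \<notin> tm_fv n" "var_x X \<notin> tm_fv n"
    and r: "tm_type r = Some (TInf X \<rightarrow> R)" "var_x X \<notin> tm_fv r"
  defines "c \<equiv> Var (var_e X R) \<cdot> n \<cdot> eps_arg X R n r"
  shows "\<Gamma> \<turnstile> (stop X R n r \<^bold>\<longrightarrow> (eps_at X R n \<cdot> r \<^bold>= zero (TInf X))) \<^bold>\<and>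
    (Neg (stop X R n r) \<^bold>\<longrightarrow> (eps_at X R n \<cdot> r \<^bold>=
       conc X \<cdot> sing X c \<cdot> (eps_at X R (suc n) \<cdot> (qsub X R \<cdot> r \<cdot> sing X c))))"
proof -
  define B where "B n r = ((stop X R n r \<^bold>\<longrightarrow> (eps_at X R n \<cdot> r \<^bold>= zero (TInf X))) \<^bold>\<and>
    (Neg (stop X R n r) \<^bold>\<longrightarrow> (eps_at X R n \<cdot> r \<^bold>=
       conc X \<cdot> sing X (Var (var_e X R) \<cdot> n \<cdot> eps_arg X R n r) \<cdot>
         (eps_at X R (suc n) \<cdot> (qsub X R \<cdot> r \<cdot> sing X (Var (var_e X R) \<cdot> n \<cdot> eps_arg X R n r))))))" for n r
  have "eps_eq X R \<in> \<Gamma>" using eps by (auto simp: eps_axioms_def)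
  then have "\<Gamma> \<turnstile> eps_eq X R" using eps_eq_sentence(1) by (rule hyp)
  then have 1: "\<Gamma> \<turnstile> All (var_l R) (All var_n (All (var_e X R) (All (var_q X R) (B (Var var_n) (Var (var_q X R))))))"
    by (simp only: eps_eq_def Let_def B_def)
  have 2: "\<Gamma> \<turnstile> All var_n (All (var_e X R) (All (var_q X R) (B (Var var_n) (Var (var_q X R)))))"
    using AllE[OF 1, of "Var (var_l R)"] by simp
  have 3: "\<Gamma> \<turnstile> All (var_e X R) (All (var_q X R) (B n (Var (var_q X R))))"
    using AllE[OF 2, of n] n by (simp add: B_def Less_def Le_def)
  have 4: "\<Gamma> \<turnstile> All (var_q X R) (B n (Var (var_q X R)))"
    using AllE[OF 3, of "Var (var_e X R)"] by simp
  have "\<Gamma> \<turnstile> B n r"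
    using AllE[OF 4, of r] n r by (simp add: B_def Less_def Le_def)
  then show ?thesis by (simp only: B_def c_def)
qed

lemma eps_stop:
  assumes n: "tm_type n = Some TNat" "var_e X R \<notin> tm_fv n" "var_q X R \<notin> tm_fv n" "var_x X \<notin> tm_fv n"
    and r: "tm_type r = Some (TInf X \<rightarrow> R)" "var_x X \<notin> tm_fv r"
    and "\<Gamma> \<turnstile> stop X R n r"
  shows "nf \<Gamma> (eps_at X R n \<cdot> r) = nf \<Gamma> (zero (TInf X))"
  using AndE1[OF eps_instance[OF n r]] assms(7) by (blast intro: nf_eqI ImpE)

lemma eps_continue:
  assumes n: "tm_type n = Some TNat" "var_e X R \<notin> tm_fv n" "var_q X R \<notin> tm_fv n" "var_x X \<notin> tm_fv n"
    and r: "tm_type r = Some (TInf X \<rightarrow> R)" "var_x X \<notin> tm_fv r"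
    and "\<Gamma> \<turnstile> Neg (stop X R n r)"
  defines "c \<equiv> Var (var_e X R) \<cdot> n \<cdot> eps_arg X R n r"
  shows "nf \<Gamma> (eps_at X R n \<cdot> r)
    = nf \<Gamma> (cons X \<cdot> c \<cdot> (eps_at X R (suc n) \<cdot> (qsub X R \<cdot> r \<cdot> sing X c)))"
proof -
  have c: "tm_type c = Some X" using n r by (simp add: c_def)
  have "nf \<Gamma> (eps_at X R n \<cdot> r)
    = nf \<Gamma> (conc X \<cdot> sing X c \<cdot> (eps_at X R (suc n) \<cdot> (qsub X R \<cdot> r \<cdot> sing X c)))"
    using AndE2[OF eps_instance[OF n r]] assms(7) unfolding c_def by (blast intro: nf_eqI ImpE)
  also have "\<dots> = nf \<Gamma> (cons X \<cdot> c \<cdot> (eps_at X R (suc n) \<cdot> (qsub X R \<cdot> r \<cdot> sing X c)))"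
    using n r c by simp
  finally show ?thesis .
qed

text \<open>
  Once the recursion has stopped, the recursive equation still holds, since \<open>0 = 0 * 0\<close>
  and the tail stops as well.
\<close>

lemma eps_unfold_stop:
  assumes n: "tm_type n = Some TNat" "var_e X R \<notin> tm_fv n" "var_q X R \<notin> tm_fv n" "var_x X \<notin> tm_fv n"
    and r: "tm_type r = Some (TInf X \<rightarrow> R)" "var_x X \<notin> tm_fv r"
    and s: "\<Gamma> \<turnstile> stop X R n r"
  defines "a \<equiv> eps_at X R n \<cdot> r \<cdot> Con CZero"
  shows "nf \<Gamma> (cons X \<cdot> a \<cdot> (eps_at X R (suc n) \<cdot> (qsub X R \<cdot> r \<cdot> sing X a)))
    = nf \<Gamma> (eps_at X R n \<cdot> r)"
proof -
  have ty: "tm_type a = Some X" using n r by (simp add: a_def)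
  note E = eps_stop[OF n r s]
  have a: "nf \<Gamma> a = nf \<Gamma> (zero X)"
    using ap_cong[OF E, of "Con CZero"] by (simp add: a_def)
  have "nf \<Gamma> (cons X \<cdot> a \<cdot> zero (TInf X)) = nf \<Gamma> (cons X \<cdot> zero X \<cdot> zero (TInf X))"
    by (intro nf_App_cong a) auto
  also have "\<dots> = nf \<Gamma> (zero (TInf X))" using cons_zero by simp
  finally have C: "nf \<Gamma> (cons X \<cdot> a \<cdot> zero (TInf X)) = nf \<Gamma> (zero (TInf X))" .
  let ?L = "\<lambda>u. suc (Var (var_l R) \<cdot> (r \<cdot> u))"
  \<comment> \<open>The value tested at the next index is the same:
    \<open>r(a * 0) = r(0)\<close>.\<close>
  have "nf \<Gamma> (qsub X R \<cdot> r \<cdot> sing X a \<cdot> zero (TInf X)) = nf \<Gamma> (r \<cdot> (cons X \<cdot> a \<cdot> zero (TInf X)))"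
    using n r ty by simp
  also have "\<dots> = nf \<Gamma> (r \<cdot> zero (TInf X))" by (rule nf_App_cong[OF HOL.refl C])
  finally have Q: "nf \<Gamma> (qsub X R \<cdot> r \<cdot> sing X a \<cdot> zero (TInf X)) = nf \<Gamma> (r \<cdot> zero (TInf X))" .
  \<comment> \<open>Raising the bound from \<open>n\<close> to \<open>n + 1\<close> only takes one
    more predecessor of a difference that is already 0.\<close>
  have "nf \<Gamma> (monus \<cdot> suc (Var (var_l R) \<cdot> (qsub X R \<cdot> r \<cdot> sing X a \<cdot> zero (TInf X))) \<cdot> suc n)
    = nf \<Gamma> (monus \<cdot> ?L (zero (TInf X)) \<cdot> suc n)"
    unfolding suc_def by (intro nf_App_cong[OF nf_App_cong[OF _ nf_App_cong[OF _ nf_App_cong[OF _ Q]]]] HOL.refl)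
  also have "\<dots> = nf \<Gamma> (pred \<cdot> (monus \<cdot> ?L (zero (TInf X)) \<cdot> n))"
    using n r by (simp add: ap_monus_Suc)
  also have "\<dots> = nf \<Gamma> (pred \<cdot> Con CZero)"
    by (rule nf_App_cong[OF HOL.refl nf_eqI[OF s[unfolded Less_def Le_def]]])
  also have "\<dots> = nf \<Gamma> (Con CZero)" by simp
  finally have s': "\<Gamma> \<turnstile> stop X R (suc n) (qsub X R \<cdot> r \<cdot> sing X a)"
    unfolding Less_def Le_def by (rule nf_eqD) (use n r ty in auto)
  have "nf \<Gamma> (eps_at X R (suc n) \<cdot> (qsub X R \<cdot> r \<cdot> sing X a)) = nf \<Gamma> (zero (TInf X))"
    by (rule eps_stop) (use n r ty s' in \<open>auto simp: a_def\<close>)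
  then have "nf \<Gamma> (cons X \<cdot> a \<cdot> (eps_at X R (suc n) \<cdot> (qsub X R \<cdot> r \<cdot> sing X a)))
      = nf \<Gamma> (cons X \<cdot> a \<cdot> zero (TInf X))"
    by (rule nf_App_cong[OF HOL.refl])
  then show ?thesis using C E by simp
qed

text \<open>The defining equation shows that the first entry \<open>a\<close> equals its
  \<open>c\<close>; replacing \<open>c\<close> by \<open>a\<close> throughout gives the
  claim.\<close>

lemma eps_unfold_continue:
  assumes n: "tm_type n = Some TNat" "var_e X R \<notin> tm_fv n" "var_q X R \<notin> tm_fv n" "var_x X \<notin> tm_fv n"
    and r: "tm_type r = Some (TInf X \<rightarrow> R)" "var_x X \<notin> tm_fv r"
    and s: "\<Gamma> \<turnstile> Neg (stop X R n r)"
  defines "a \<equiv> eps_at X R n \<cdot> r \<cdot> Con CZero"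
  shows "nf \<Gamma> (cons X \<cdot> a \<cdot> (eps_at X R (suc n) \<cdot> (qsub X R \<cdot> r \<cdot> sing X a)))
    = nf \<Gamma> (eps_at X R n \<cdot> r)"
proof -
  let ?c = "Var (var_e X R) \<cdot> n \<cdot> eps_arg X R n r"
  note E = eps_continue[OF n r s]
  have "nf \<Gamma> a = nf \<Gamma> (cons X \<cdot> ?c \<cdot> (eps_at X R (suc n) \<cdot> (qsub X R \<cdot> r \<cdot> sing X ?c)) \<cdot> Con CZero)"
    unfolding a_def by (rule nf_App_cong[OF E HOL.refl])
  also have "\<dots> = nf \<Gamma> ?c" using n r by simp
  finally have a: "nf \<Gamma> a = nf \<Gamma> ?c" .
  have "nf \<Gamma> (cons X \<cdot> a \<cdot> (eps_at X R (suc n) \<cdot> (qsub X R \<cdot> r \<cdot> sing X a)))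
      = nf \<Gamma> (cons X \<cdot> ?c \<cdot> (eps_at X R (suc n) \<cdot> (qsub X R \<cdot> r \<cdot> sing X ?c)))"
    unfolding sing_def by (intro nf_App_cong a[unfolded sing_def] HOL.refl)
  then show ?thesis using E by (simp only:)
qed

text \<open>Disjunction elimination on the decidable stopping condition. Expressed through the first
  entry \<open>a\<close>, the equation has one form in both cases, and the induction for \<alpha>
  needs no case distinction.\<close>

lemma eps_unfold:
  assumes n: "tm_type n = Some TNat" "var_e X R \<notin> tm_fv n" "var_q X R \<notin> tm_fv n" "var_x X \<notin> tm_fv n"
    and r: "tm_type r = Some (TInf X \<rightarrow> R)" "var_x X \<notin> tm_fv r"
  defines "a \<equiv> eps_at X R n \<cdot> r \<cdot> Con CZero"
  shows "nf \<Gamma> (cons X \<cdot> a \<cdot> (eps_at X R (suc n) \<cdot> (qsub X R \<cdot> r \<cdot> sing X a)))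
    = nf \<Gamma> (eps_at X R n \<cdot> r)"
proof -
  let ?C = "cons X \<cdot> a \<cdot> (eps_at X R (suc n) \<cdot> (qsub X R \<cdot> r \<cdot> sing X a))"
  have ty: "tm_type ?C \<noteq> None" using n r by (simp add: a_def)
  have wf: "wf_fm (stop X R n r)" using n r by (simp add: Less_def Le_def)
  have "\<Gamma> \<turnstile> stop X R n r \<^bold>\<or> Neg (stop X R n r)"
    unfolding Less_def Le_def by (rule nat_eq_zero_decidable) (use n r in auto)
  moreover have "insert (stop X R n r) \<Gamma> \<turnstile> ?C \<^bold>= eps_at X R n \<cdot> r"
    using eps_ctx.eps_unfold_stop[OF eps_ctx_insert n r hyp[OF insertI1 wf]] ty
    unfolding a_def by (rule nf_eqD)
  moreover have "insert (Neg (stop X R n r)) \<Gamma> \<turnstile> ?C \<^bold>= eps_at X R n \<cdot> r"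
  proof -
    have "insert (Neg (stop X R n r)) \<Gamma> \<turnstile> Neg (stop X R n r)" by (rule hyp) (use wf in auto)
    from eps_ctx.eps_unfold_continue[OF eps_ctx_insert n r this] ty show ?thesis
      unfolding a_def by (rule nf_eqD)
  qed
  ultimately have "\<Gamma> \<turnstile> ?C \<^bold>= eps_at X R n \<cdot> r" by (rule OrE)
  then show ?thesis by (rule nf_eqI)
qed

end

section \<open>The sequence \<alpha> split at an index\<close>

abbreviation alpha :: "ty \<Rightarrow> ty \<Rightarrow> tm" where
  "alpha X R \<equiv> eps_at X R (Con CZero) \<cdot> Var (var_q X R)"

abbreviation alpha_init :: "ty \<Rightarrow> ty \<Rightarrow> tm \<Rightarrow> tm" where
  "alpha_init X R n \<equiv> init X \<cdot> alpha X R \<cdot> n"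

text \<open>The candidate for the part of \<alpha> from index \<open>n\<close> on;
  \<open>alpha_split\<close> proves that it is this part.\<close>

abbreviation alpha_tail :: "ty \<Rightarrow> ty \<Rightarrow> tm \<Rightarrow> tm" where
  "alpha_tail X R n \<equiv> eps_at X R n \<cdot> (qsub X R \<cdot> Var (var_q X R) \<cdot> alpha_init X R n)"

context eps_ctx
begin

text \<open>The splitting is a premise because the induction step that establishes the splitting at
  \<open>n + 1\<close> already uses this at \<open>n\<close>.\<close>

lemma alpha_nth:
  assumes n: "tm_type n = Some TNat"
    and split: "nf \<Gamma> (conc X \<cdot> alpha_init X R n \<cdot> alpha_tail X R n) = nf \<Gamma> (alpha X R)"
  shows "nf \<Gamma> (alpha X R \<cdot> n) = nf \<Gamma> (alpha_tail X R n \<cdot> Con CZero)"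
proof -
  have "nf \<Gamma> (alpha X R \<cdot> n) = nf \<Gamma> (conc X \<cdot> alpha_init X R n \<cdot> alpha_tail X R n \<cdot> n)"
    by (rule nf_App_cong[OF split[symmetric] HOL.refl])
  also have "\<dots> = nf \<Gamma> (alpha_tail X R n \<cdot> Con CZero)"
    using conc_init_nth[of n "alpha X R" X "alpha_tail X R n"] n by simp
  finally show ?thesis .
qed

text \<open>By \<open>alpha_nth\<close> the entry appended to the segment is the first entry of the
  tail. It moves across the concatenation, and \<open>eps_unfold\<close> recognizes it followed by
  the tail at \<open>n + 1\<close> as the tail at \<open>n\<close>.\<close>

lemma alpha_split_Suc:
  assumes n: "tm_type n = Some TNat" "var_e X R \<notin> tm_fv n" "var_q X R \<notin> tm_fv n" "var_x X \<notin> tm_fv n"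
    and split: "nf \<Gamma> (conc X \<cdot> alpha_init X R n \<cdot> alpha_tail X R n) = nf \<Gamma> (alpha X R)"
  shows "nf \<Gamma> (conc X \<cdot> alpha_init X R (suc n) \<cdot> alpha_tail X R (suc n)) = nf \<Gamma> (alpha X R)"
proof -
  let ?s = "alpha_init X R n" and ?a = "alpha_tail X R n \<cdot> Con CZero"
  let ?s' = "Con (CSnoc X) \<cdot> ?s \<cdot> ?a" and ?q = "Var (var_q X R)"
  have "nf \<Gamma> (alpha_init X R (suc n)) = nf \<Gamma> (Con (CSnoc X) \<cdot> ?s \<cdot> (alpha X R \<cdot> n))"
    using n by simp
  also have "\<dots> = nf \<Gamma> ?s'"
    by (rule nf_App_cong[OF HOL.refl alpha_nth[OF n(1) split]])
  finally have s': "nf \<Gamma> (alpha_init X R (suc n)) = nf \<Gamma> ?s'" .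
  have "nf \<Gamma> (qsub X R \<cdot> ?q \<cdot> alpha_init X R (suc n)) = nf \<Gamma> (qsub X R \<cdot> ?q \<cdot> ?s')"
    by (rule nf_App_cong[OF HOL.refl s'])
  also have "\<dots> = nf \<Gamma> (qsub X R \<cdot> (qsub X R \<cdot> ?q \<cdot> ?s) \<cdot> sing X ?a)"
    using qsub_snoc[of ?q X R ?s ?a] n by simp
  finally have "nf \<Gamma> (conc X \<cdot> alpha_init X R (suc n) \<cdot> alpha_tail X R (suc n))
    = nf \<Gamma> (conc X \<cdot> ?s' \<cdot> (eps_at X R (suc n) \<cdot> (qsub X R \<cdot> (qsub X R \<cdot> ?q \<cdot> ?s) \<cdot> sing X ?a)))"
    by (intro nf_App_cong[OF nf_App_cong[OF HOL.refl s'] nf_App_cong[OF HOL.refl]])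
  also have "\<dots> = nf \<Gamma> (conc X \<cdot> ?s \<cdot>
      (cons X \<cdot> ?a \<cdot> (eps_at X R (suc n) \<cdot> (qsub X R \<cdot> (qsub X R \<cdot> ?q \<cdot> ?s) \<cdot> sing X ?a))))"
    using n by simp
  also have "\<dots> = nf \<Gamma> (conc X \<cdot> ?s \<cdot> alpha_tail X R n)"
    by (rule nf_App_cong[OF HOL.refl eps_unfold]) (use n in auto)
  finally show ?thesis using split by (rule trans)
qed

lemma alpha_split:
  assumes n: "tm_type n = Some TNat"
  shows "nf \<Gamma> (conc X \<cdot> alpha_init X R n \<cdot> alpha_tail X R n) = nf \<Gamma> (alpha X R)"
proof -
  let ?Z = "Con CZero"
  obtain f where f: "tm_type f = Some (TNat \<rightarrow> TNat \<rightarrow> TNat \<rightarrow> TInf X)"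
    "\<And>\<Delta> a b c. ctx \<Delta> \<Longrightarrow> tm_type a = Some TNat \<Longrightarrow> tm_type b = Some TNat \<Longrightarrow> tm_type c = Some TNat \<Longrightarrow>
      ap \<Delta> (ap \<Delta> (ap \<Delta> f a) b) c = nf \<Delta> (conc X \<cdot> alpha_init X R c \<cdot> alpha_tail X R c)"
    by (rule combinatory_completeness[where F = "\<lambda>a b c. conc X \<cdot> alpha_init X R c \<cdot> alpha_tail X R c"
          and A = "{var_l R, var_e X R, var_q X R}"
          and ?S1.0 = TNat and ?S2.0 = TNat and ?S3.0 = TNat and T = "TInf X"])
      (auto simp: subst_stable_def)
  obtain g where g: "tm_type g = Some (TNat \<rightarrow> TNat \<rightarrow> TNat \<rightarrow> TInf X)"
    "\<And>\<Delta> a b c. ctx \<Delta> \<Longrightarrow> tm_type a = Some TNat \<Longrightarrow> tm_type b = Some TNat \<Longrightarrow> tm_type c = Some TNat \<Longrightarrow>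
      ap \<Delta> (ap \<Delta> (ap \<Delta> g a) b) c = nf \<Delta> (alpha X R)"
    by (rule combinatory_completeness[where F = "\<lambda>a b c. alpha X R"
          and A = "{var_l R, var_e X R, var_q X R}"
          and ?S1.0 = TNat and ?S2.0 = TNat and ?S3.0 = TNat and T = "TInf X"])
      (auto simp: subst_stable_def)
  let ?f = "f \<cdot> ?Z \<cdot> ?Z" and ?g = "g \<cdot> ?Z \<cdot> ?Z"
  have fg: "ap \<Delta> ?f c = nf \<Delta> (conc X \<cdot> alpha_init X R c \<cdot> alpha_tail X R c)"
    "ap \<Delta> ?g c = nf \<Delta> (alpha X R)" if "ctx \<Delta>" "tm_type c = Some TNat" for \<Delta> c
    using f(2)[OF that(1), of ?Z ?Z c] g(2)[OF that(1), of ?Z ?Z c] that(2) by simp_all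
  have "nf \<Gamma> ?f = nf \<Gamma> ?g"
  \<comment> \<open>\<open>X\<close> may itself be the type of numbers, so the induction variable
    must be kept apart from the \<open>x\<close> bound in the defining equation.\<close>
  proof (rule nf_nat_ext[where A = "{var_x X}"])
    let ?q = "Var (var_q X R)"
    \<comment> \<open>In the base case the segment is empty, and \<open>q\<close> at the empty
      segment is \<open>q\<close> by extensionality.\<close>
    have Q: "nf \<Gamma> (qsub X R \<cdot> ?q \<cdot> Con (CEmpty X)) = nf \<Gamma> ?q"
      by (rule nf_ext) auto
    have "ap \<Gamma> h (ap \<Gamma> (ap \<Gamma> (qsub X R) ?q) (Con (CEmpty X))) = ap \<Gamma> h ?q" for h
      using nf_App_cong[OF HOL.refl Q, of h] by simp
    then have "nf \<Gamma> (conc X \<cdot> alpha_init X R ?Z \<cdot> alpha_tail X R ?Z) = nf \<Gamma> (alpha X R)" by simp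
    then show "ap \<Gamma> ?f ?Z = ap \<Gamma> ?g ?Z" using fg[OF ctx_axioms, of ?Z] by (simp only: tm_type.simps const_type.simps)
    fix y :: var and \<Delta>
    assume y: "snd y = TNat" "y \<notin> {var_x X}" and "\<Gamma> \<subseteq> \<Delta>" "ctx \<Delta>"
      and IH: "(?f \<cdot> Var y \<^bold>= ?g \<cdot> Var y) \<in> \<Delta>"
    interpret \<Delta>: eps_ctx \<Delta>
      using \<open>ctx \<Delta>\<close> \<open>\<Gamma> \<subseteq> \<Delta>\<close> eps by (auto simp: eps_ctx_def eps_ctx_axioms_def)
    have "ap \<Delta> ?f (Var y) = ap \<Delta> ?g (Var y)" using ap_hyp[OF IH] f g y by simp
    then have "nf \<Delta> (conc X \<cdot> alpha_init X R (Var y) \<cdot> alpha_tail X R (Var y)) = nf \<Delta> (alpha X R)"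
      using fg[OF \<open>ctx \<Delta>\<close>, of "Var y"] y by simp
    then have "nf \<Delta> (conc X \<cdot> alpha_init X R (suc (Var y)) \<cdot> alpha_tail X R (suc (Var y))) = nf \<Delta> (alpha X R)"
      by (rule \<Delta>.alpha_split_Suc[rotated -1]) (use y in auto)
    then have "ap \<Delta> ?f (Con CSuc \<cdot> Var y) = ap \<Delta> ?g (Con CSuc \<cdot> Var y)"
      using fg[OF \<open>ctx \<Delta>\<close>, of "Con CSuc \<cdot> Var y"] y by simp
    then show "ap \<Delta> ?f (ap \<Delta> (Con CSuc) (Var y)) = ap \<Delta> ?g (ap \<Delta> (Con CSuc) (Var y))"
      by simp
  qed (use f g in auto)
  from ap_cong[OF this, of n] show ?thesis unfolding fg[OF ctx_axioms n] .
qed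

lemma not_stop:
  assumes n: "tm_type n = Some TNat" "var_e X R \<notin> tm_fv n" "var_q X R \<notin> tm_fv n" "var_x X \<notin> tm_fv n"
    and le: "Le n (Var (var_l R) \<cdot> (Var (var_q X R) \<cdot> alpha X R)) \<in> \<Gamma>"
    and s: "\<Gamma> \<turnstile> stop X R n (qsub X R \<cdot> Var (var_q X R) \<cdot> alpha_init X R n)"
  shows "\<Gamma> \<turnstile> Fls"
proof -
  let ?l = "Var (var_l R)" and ?q = "Var (var_q X R)" and ?s = "alpha_init X R n"
  have tail: "nf \<Gamma> (alpha_tail X R n) = nf \<Gamma> (zero (TInf X))"
    by (rule eps_stop) (use n s in auto)
  have "nf \<Gamma> (qsub X R \<cdot> ?q \<cdot> ?s \<cdot> zero (TInf X)) = nf \<Gamma> (?q \<cdot> (conc X \<cdot> ?s \<cdot> zero (TInf X)))"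
    using n by simp
  \<comment> \<open>With a zero tail, \<open>alpha_split\<close> reads \<alpha> =
    \<open>s * 0\<close>, so the value tested by the stopping condition is \<open>q\<close> at
    \<alpha>.\<close>
  also have "nf \<Gamma> (conc X \<cdot> ?s \<cdot> zero (TInf X)) = nf \<Gamma> (alpha X R)"
    using nf_App_cong[OF HOL.refl tail, of "conc X \<cdot> ?s"] alpha_split[OF n(1), of X R] by (simp only:)
  then have "nf \<Gamma> (?q \<cdot> (conc X \<cdot> ?s \<cdot> zero (TInf X))) = nf \<Gamma> (?q \<cdot> alpha X R)"
    by (rule nf_App_cong[OF HOL.refl])
  finally have q: "nf \<Gamma> (qsub X R \<cdot> ?q \<cdot> ?s \<cdot> zero (TInf X)) = nf \<Gamma> (?q \<cdot> alpha X R)" .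
  have "nf \<Gamma> (monus \<cdot> (Con CSuc \<cdot> (?l \<cdot> (?q \<cdot> alpha X R))) \<cdot> n)
    = nf \<Gamma> (monus \<cdot> (Con CSuc \<cdot> (?l \<cdot> (qsub X R \<cdot> ?q \<cdot> ?s \<cdot> zero (TInf X)))) \<cdot> n)"
    by (intro nf_App_cong[OF nf_App_cong[OF _ nf_App_cong[OF _ nf_App_cong[OF _ q[symmetric]]]]] HOL.refl)
  also have "\<dots> = nf \<Gamma> (Con CZero)"
    using nf_eqI[OF s[unfolded Less_def Le_def suc_def]] .
  finally have less: "nf \<Gamma> (monus \<cdot> (Con CSuc \<cdot> (?l \<cdot> (?q \<cdot> alpha X R))) \<cdot> n) = nf \<Gamma> (Con CZero)" .
  have "\<Gamma> \<turnstile> Le n (?l \<cdot> (?q \<cdot> alpha X R))" using le by (rule hyp) (use n in \<open>simp add: Le_def\<close>)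
  from nf_eqI[OF this[unfolded Le_def]] less show ?thesis
    by (intro monus_contradiction[of "?l \<cdot> (?q \<cdot> alpha X R)" n]) (use n in auto)
qed

lemma alpha_eq:
  assumes n: "tm_type n = Some TNat" "var_e X R \<notin> tm_fv n" "var_q X R \<notin> tm_fv n" "var_x X \<notin> tm_fv n"
    and le: "Le n (Var (var_l R) \<cdot> (Var (var_q X R) \<cdot> alpha X R)) \<in> \<Gamma>"
  defines "p \<equiv> Lam (var_x X) (ovl (TInf X) R \<cdot> eps_at X R (suc n)
      \<cdot> (qsub X R \<cdot> Var (var_q X R) \<cdot> (Con (CSnoc X) \<cdot> alpha_init X R n \<cdot> Var (var_x X))))"
  shows "\<Gamma> \<turnstile> alpha X R \<cdot> n \<^bold>= Var (var_e X R) \<cdot> n \<cdot> p"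
    and "\<Gamma> \<turnstile> p \<cdot> (alpha X R \<cdot> n) \<^bold>= Var (var_q X R) \<cdot> alpha X R"
proof -
  let ?q = "Var (var_q X R)" and ?r = "qsub X R \<cdot> Var (var_q X R) \<cdot> alpha_init X R n"
  have tp: "tm_type p = Some (X \<rightarrow> R)" using n by (simp add: p_def)
  have wf: "wf_fm (stop X R n ?r)" using n by (simp add: Less_def Le_def)
  \<comment> \<open>Negation is implication to falsity, so the refutation is carried out with the
    stopping condition as an added hypothesis.\<close>
  have "insert (stop X R n ?r) \<Gamma> \<turnstile> Fls"
    by (rule eps_ctx.not_stop[OF eps_ctx_insert n]) (use le wf in \<open>auto intro: hyp\<close>)
  then have s: "\<Gamma> \<turnstile> Neg (stop X R n ?r)" using wf by (rule ImpI)
  let ?c = "Var (var_e X R) \<cdot> n \<cdot> eps_arg X R n ?r"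
  have p: "ap \<Gamma> p a = nf \<Gamma> (ovl (TInf X) R \<cdot> eps_at X R (suc n)
      \<cdot> (qsub X R \<cdot> ?q \<cdot> (Con (CSnoc X) \<cdot> alpha_init X R n \<cdot> a)))" if "tm_type a = Some X" for a
    using that n by (simp add: p_def)
  \<comment> \<open>The selection function receives the functional built from \<open>q\<close> at
    the segment and then at \<open>x\<close>; \<open>qsub_snoc\<close> identifies it with
    \<open>p\<close>.\<close>
  have "nf \<Gamma> (eps_arg X R n ?r) = nf \<Gamma> p"
    by (rule nf_ext) (use n in \<open>auto simp: tp p qsub_snoc\<close>)
  then have cp: "nf \<Gamma> ?c = nf \<Gamma> (Var (var_e X R) \<cdot> n \<cdot> p)" by (rule nf_App_cong[OF HOL.refl])
  have "nf \<Gamma> (alpha X R \<cdot> n) = nf \<Gamma> (alpha_tail X R n \<cdot> Con CZero)"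
    by (rule alpha_nth[OF n(1) alpha_split[OF n(1)]])
  also have "\<dots> = nf \<Gamma> (cons X \<cdot> ?c \<cdot> (eps_at X R (suc n) \<cdot> (qsub X R \<cdot> ?r \<cdot> sing X ?c)) \<cdot> Con CZero)"
    by (rule nf_App_cong[OF eps_continue HOL.refl]) (use n s in auto)
  also have "\<dots> = nf \<Gamma> ?c" using n by simp
  finally show "\<Gamma> \<turnstile> alpha X R \<cdot> n \<^bold>= Var (var_e X R) \<cdot> n \<cdot> p"
    using cp n by (intro nf_eqD) auto
  have "nf \<Gamma> (p \<cdot> (alpha X R \<cdot> n)) = nf \<Gamma> (ovl (TInf X) R \<cdot> eps_at X R (suc n)
      \<cdot> (qsub X R \<cdot> ?q \<cdot> (Con (CSnoc X) \<cdot> alpha_init X R n \<cdot> (alpha X R \<cdot> n))))"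
    using p[of "alpha X R \<cdot> n"] n by simp
  \<comment> \<open>Appending \<alpha>(n) to the segment gives the segment of length
    \<open>n + 1\<close>, and unfolding \<open>ovl\<close> evaluates \<open>q\<close> at that
    segment followed by its tail; \<open>alpha_split\<close> at \<open>n + 1\<close> then
    applies.\<close>
  also have "\<dots> = nf \<Gamma> (?q \<cdot> (conc X \<cdot> alpha_init X R (suc n) \<cdot> alpha_tail X R (suc n)))"
    using n by simp
  also have "\<dots> = nf \<Gamma> (?q \<cdot> alpha X R)"
    by (rule nf_App_cong[OF HOL.refl alpha_split]) (use n in auto)
  finally show "\<Gamma> \<turnstile> p \<cdot> (alpha X R \<cdot> n) \<^bold>= ?q \<cdot> alpha X R"
    using n tp by (intro nf_eqD) auto
qed

end

theorem theorem3p8: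
  fixes X R :: ty
  shows "let
      vq = (''q'', TInf X \<rightarrow> R); vl = (''l'', R \<rightarrow> TNat); ve = (''e'', TNat \<rightarrow> TSel R X);
      vn = (''n'', TNat); vx = (''x'', X);
      q = Var vq; l = Var vl; e = Var ve; n = Var vn; x = Var vx;
      eps = Con (CEps X R);
      \<alpha> = eps \<cdot> l \<cdot> Con CZero \<cdot> e \<cdot> q;
      p = Lam vx (ovl (TInf X) R \<cdot> (eps \<cdot> l \<cdot> suc n \<cdot> e)
            \<cdot> (qsub X R \<cdot> q \<cdot> (Con (CSnoc X) \<cdot> (init X \<cdot> \<alpha> \<cdot> n) \<cdot> x)))
    in eps_axioms \<turnstile>
      All vq (All vl (All ve (All vn (
        Le n (l \<cdot> (q \<cdot> \<alpha>)) \<^bold>\<longrightarrow>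
          (\<alpha> \<cdot> n \<^bold>= e \<cdot> n \<cdot> p) \<^bold>\<and> (p \<cdot> (\<alpha> \<cdot> n) \<^bold>= q \<cdot> \<alpha>)))))"
proof -
  \<comment> \<open>The axioms are sentences, so all four variables may be generalized once the
    bound on \<open>n\<close> has been discharged.\<close>
  have closed: "\<forall>\<psi>\<in>eps_axioms. v \<notin> fm_fv \<psi>" for v
    by (auto simp: eps_axioms_def eps_eq_sentence)
  then have "\<Union>(fm_fv ` eps_axioms) = {}" by blast
  then have "eps_ctx eps_axioms" by unfold_locales simp_all
  then interpret G: eps_ctx "insert (Le (Var var_n) (Var (var_l R) \<cdot> (Var (var_q X R) \<cdot> alpha X R))) eps_axioms"
    by (rule eps_ctx.eps_ctx_insert)
  show ?thesis
    unfolding Let_def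
    by (intro AllI closed ImpI AndI G.alpha_eq) (auto simp: Le_def)
qed

end
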